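(* Let $M$ be a proper semi-invariant submanifold of a normal complex contact metric manifold $\bar M$, with invariant distribution $\mathcal D$ and anti-invariant distribution $\mathcal D^{\bot}$. Then the distribution $\mathcal D\oplus\mathcal D^{\bot}$ on $M$ is not involutive.
   Context: Complex contact metric manifolds. A complex contact manifold is a complex manifold $\bar M$ of complex dimension $2m+1$ with an open cover by coordinate neighborhoods $\mathcal U_i$ and holomorphic $1$-forms $\omega_i$ on $\mathcal U_i$ with $\omega_i\wedge(d\omega_i)^m\neq 0$ on $\mathcal U_i$ and $\omega_i=f_{ij}\omega_j$ on $\mathcal U_i\cap\mathcal U_j\ne\emptyset$ with $f_{ij}$ holomorphic. The kernels of the $\omega_i$ define the horizontal subbundle $\mathcal H\subset T\bar M$. Let $\bar J$ be the complex structure and $\bar g$ a Hermitian metric. A complex almost contact metric structure consists, on each $\mathcal U_i$ (index suppressed), of real $1$-forms $\bar u$, $\bar v=\bar u\circ \bar J$, with dual unit vector fields $\bar U$, $\bar V=-\bar J\bar U$, and $(1,1)$-tensor fields $\bar G$, $\bar H=\bar G\bar J$ such that $\bar G^2=\bar H^2=-I+\bar u\otimes\bar U+\bar v\otimes\bar V$, $\bar G\bar J=-\bar J\bar G$, $\bar G\bar U=0$, $\bar g(K,\bar GL)=-\bar g(\bar GK,L)$; on overlaps $u_j=cu_i-dv_i$, $v_j=du_i+cv_i$, $G_j=cG_i-dH_i$, $H_j=dG_i+cH_i$ for functions $c,d$ with $c^2+d^2=1$. Let $\bar\nabla$ be the Levi-Civita connection of $\bar g$ and $\bar\sigma(K)=\bar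 g(\bar\nabla_K\bar U,\bar V)$. $\bar M$ is a complex contact metric manifold if moreover $\mathcal H=\ker\bar u\cap\ker\bar v$ and $d\bar u(K,L)=\bar g(K,\bar GL)+(\bar\sigma\wedge\bar v)(K,L)$, $d\bar v(K,L)=\bar g(K,\bar HL)-(\bar\sigma\wedge\bar u)(K,L)$ (conventions $2d\alpha(K,L)=K\alpha(L)-L\alpha(K)-\alpha([K,L])$ and $2(\alpha\wedge\beta)(K,L)=\alpha(K)\beta(L)-\alpha(L)\beta(K)$). Normality (Korkmaz). For a $(1,1)$-tensor $F$ put $[F,F](K,L)=(\bar\nabla_{FK}F)L-(\bar\nabla_{FL}F)K-F(\bar\nabla_KF)L+F(\bar\nabla_LF)K$. Define $S(K,L)=[\bar G,\bar G](K,L)+2\bar g(K,\bar GL)\bar U-2\bar g(K,\bar HL)\bar V+2(\bar v(L)\bar HK-\bar v(K)\bar HL)+\bar\sigma(\bar GL)\bar HK-\bar\sigma(\bar GK)\bar HL+\bar\sigma(K)\bar G\bar HL-\bar\sigma(L)\bar G\bar HK$, $T(K,L)=[\bar H,\bar H](K,L)-2\bar g(K,\bar GL)\bar U+2\bar g(K,\bar HL)\bar V+2(\bar u(L)\bar GK-\bar u(K)\bar GL)+\bar\sigma(\bar HK)\bar GL-\bar\sigma(\bar HL)\bar GK+\bar\sigma(K)\bar G\bar HL-\bar\sigma(L)\bar G\bar HK$. $\bar M$ is normal if $S(K,L)=T(K,L)=0$ for all $K,L\in\mathcal H$ and $S(K,\bar U)=T(K,\bar V)=0$ for all $K$. Semi-invariant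 submanifolds. Let $M$ be a complex submanifold of the normal complex contact metric manifold $\bar M$ (real dimension $4m+2$), of real dimension $n+2$, with $\bar U,\bar V$ tangent to $M$. $M$ is semi-invariant if there are smooth distributions $\mathcal D,\mathcal D^{\bot}$ on $M$, orthogonal to $sp\{\bar U,\bar V\}$ (the span of $\bar U,\bar V$), with $TM=\mathcal D\oplus\mathcal D^{\bot}\oplus sp\{\bar U,\bar V\}$ (orthogonal sum), $\bar G\mathcal D=\mathcal D$, $\bar H\mathcal D=\mathcal D$, $\bar G\mathcal D^{\bot}\subset TM^{\bot}$, $\bar H\mathcal D^{\bot}\subset TM^{\bot}$, where $TM^\bot$ is the normal bundle. $\mathcal D$ is called the invariant and $\mathcal D^{\bot}$ the anti-invariant distribution; both have constant rank. $M$ is an invariant submanifold if $\dim\mathcal D^{\bot}=0$, an anti-invariant submanifold if $\dim\mathcal D=0$, and a proper semi-invariant submanifold if it is neither. *)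

theory Defs
  imports "HOL-Analysis.Analysis" "HOL-Library.Function_Algebras"
begin

section \<open>Smooth and holomorphic maps between open subsets of coordinate spaces\<close>

primrec Ck_on :: "nat \<Rightarrow> ('e::real_normed_vector \<Rightarrow> 'f::real_normed_vector) \<Rightarrow> 'e set \<Rightarrow> bool" where
  "Ck_on 0 f S \<longleftrightarrow> continuous_on S f"
| "Ck_on (Suc n) f S \<longleftrightarrow> (\<forall>x\<in>S. f differentiable (at x)) \<and>
     (\<forall>v. Ck_on n (\<lambda>x. frechet_derivative f (at x) v) S)"

text \<open>Used only for open sets in finite-dimensional spaces, where it means that all iterated
  partial derivatives exist and are continuous.\<close>

definition smooth_on :: "'e set \<Rightarrow> ('e::real_normed_vector \<Rightarrow> 'f::real_normed_vector) \<Rightarrow> bool" where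
  "smooth_on S f \<longleftrightarrow> (\<forall>n. Ck_on n f S)"

text \<open>Holomorphic functions of several complex variables: smooth functions satisfying the
  Cauchy--Riemann equations, i.e. whose real differential is complex linear.\<close>

definition hol_on :: "(complex ^ 'k::finite) set \<Rightarrow> (complex ^ 'k \<Rightarrow> complex) \<Rightarrow> bool" where
  "hol_on S f \<longleftrightarrow> smooth_on S f \<and>
     (\<forall>x\<in>S. \<forall>v. frechet_derivative f (at x) (\<i> *s v) = \<i> * frechet_derivative f (at x) v)"

definition hol_map_on ::
  "(complex ^ 'k::finite) set \<Rightarrow> (complex ^ 'k \<Rightarrow> complex ^ 'l::finite) \<Rightarrow> bool" where
  "hol_map_on S f \<longleftrightarrow> (\<forall>j. hol_on S (\<lambda>x. f x $ j))"

section \<open>Complex manifolds\<close>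

text \<open>The values of a chart outside its domain are irrelevant. A manifold of complex dimension
  \<open>CARD('k)\<close> is modelled on \<open>complex ^ 'k\<close>; its points form the set \<open>topspace (mtop M)\<close>.\<close>

type_synonym ('a, 'k) chart = "'a set \<times> ('a \<Rightarrow> complex ^ 'k)"

record ('a, 'k::finite) cmanifold =
  mtop :: "'a topology"
  atlas :: "('a, 'k) chart set"

abbreviation points :: "('a, 'k::finite, 'z) cmanifold_scheme \<Rightarrow> 'a set" where
  "points M \<equiv> topspace (mtop M)"

definition cinv :: "('a, 'k::finite) chart \<Rightarrow> complex ^ 'k \<Rightarrow> 'a" where
  "cinv c = inv_into (fst c) (snd c)"

definition cimg :: "('a, 'k::finite) chart \<Rightarrow> 'a set \<Rightarrow> (complex ^ 'k) set" where
  "cimg c W = snd c ` (W \<inter> fst c)"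

definition transition ::
  "('a, 'k::finite) chart \<Rightarrow> ('a, 'l::finite) chart \<Rightarrow> complex ^ 'k \<Rightarrow> complex ^ 'l" where
  "transition c d = snd d \<circ> cinv c"

definition is_chart :: "'a topology \<Rightarrow> ('a, 'k::finite) chart \<Rightarrow> bool" where
  "is_chart X c \<longleftrightarrow> openin X (fst c) \<and> open (snd c ` fst c) \<and>
     homeomorphic_map (subtopology X (fst c)) (top_of_set (snd c ` fst c)) (snd c)"

definition compatible :: "('a, 'k::finite) chart \<Rightarrow> ('a, 'k) chart \<Rightarrow> bool" where
  "compatible c d \<longleftrightarrow> hol_map_on (cimg c (fst d)) (transition c d) \<and>
                     hol_map_on (cimg d (fst c)) (transition d c)"

definition complex_manifold :: "('a, 'k::finite, 'z) cmanifold_scheme \<Rightarrow> bool" where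
  "complex_manifold M \<longleftrightarrow>
     Hausdorff_space (mtop M) \<and> second_countable (mtop M) \<and>
     (\<forall>c\<in>atlas M. is_chart (mtop M) c) \<and>
     (\<Union>c\<in>atlas M. fst c) = points M \<and>
     (\<forall>c\<in>atlas M. \<forall>d\<in>atlas M. compatible c d) \<and>
     (\<forall>c. is_chart (mtop M) c \<and> (\<forall>d\<in>atlas M. compatible c d) \<longrightarrow> c \<in> atlas M)"

section \<open>Tangent vectors, vector fields and forms\<close>

instantiation "fun" :: (type, real_vector) real_vector
begin

definition scaleR_fun :: "real \<Rightarrow> ('a \<Rightarrow> 'b) \<Rightarrow> 'a \<Rightarrow> 'b" where
  "scaleR_fun a f = (\<lambda>x. a *\<^sub>R f x)"

instance
  by standard (auto simp: scaleR_fun_def fun_eq_iff scaleR_add_right scaleR_add_left)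

end

text \<open>A tangent vector at \<open>p\<close> is the family of its coordinate vectors in all charts around \<open>p\<close>,
  related by the differentials of the transition maps (and \<open>0\<close> at all other indices). These
  families form a linear subspace of the real vector space \<open>chart \<Rightarrow> complex ^ 'k\<close>, so that
  \<open>subspace\<close>, \<open>span\<close> and \<open>dim\<close> refer to real linear algebra in the tangent space.\<close>

type_synonym ('a, 'k) tvec = "('a, 'k) chart \<Rightarrow> complex ^ 'k"

definition tspace :: "('a, 'k::finite, 'z) cmanifold_scheme \<Rightarrow> 'a \<Rightarrow> ('a, 'k) tvec set" where
  "tspace M p = {\<xi>.
     (\<forall>c\<in>atlas M. \<forall>d\<in>atlas M. p \<in> fst c \<and> p \<in> fst d \<longrightarrow>
        \<xi> d = frechet_derivative (transition c d) (at (snd c p)) (\<xi> c)) \<and>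
     (\<forall>c. \<not> (c \<in> atlas M \<and> p \<in> fst c) \<longrightarrow> \<xi> c = 0)}"

definition cstruct :: "('a, 'k::finite) tvec \<Rightarrow> ('a, 'k) tvec" where
  "cstruct \<xi> = (\<lambda>c. \<i> *s \<xi> c)"

definition vfield ::
  "('a, 'k::finite, 'z) cmanifold_scheme \<Rightarrow> 'a set \<Rightarrow> ('a \<Rightarrow> ('a, 'k) tvec) \<Rightarrow> bool" where
  "vfield M W X \<longleftrightarrow> (\<forall>p\<in>W. X p \<in> tspace M p) \<and>
     (\<forall>c\<in>atlas M. smooth_on (cimg c W) (\<lambda>x. X (cinv c x) c))"

definition hol_vfield ::
  "('a, 'k::finite, 'z) cmanifold_scheme \<Rightarrow> 'a set \<Rightarrow> ('a \<Rightarrow> ('a, 'k) tvec) \<Rightarrow> bool" where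
  "hol_vfield M W X \<longleftrightarrow> (\<forall>p\<in>W. X p \<in> tspace M p) \<and>
     (\<forall>c\<in>atlas M. hol_map_on (cimg c W) (\<lambda>x. X (cinv c x) c))"

definition smooth_fun ::
  "('a, 'k::finite, 'z) cmanifold_scheme \<Rightarrow> 'a set \<Rightarrow> ('a \<Rightarrow> 'b::real_normed_vector) \<Rightarrow> bool" where
  "smooth_fun M W f \<longleftrightarrow> (\<forall>c\<in>atlas M. smooth_on (cimg c W) (f \<circ> cinv c))"

definition hol_fun ::
  "('a, 'k::finite, 'z) cmanifold_scheme \<Rightarrow> 'a set \<Rightarrow> ('a \<Rightarrow> complex) \<Rightarrow> bool" where
  "hol_fun M W f \<longleftrightarrow> (\<forall>c\<in>atlas M. hol_on (cimg c W) (f \<circ> cinv c))"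

definition chart_at :: "('a, 'k::finite, 'z) cmanifold_scheme \<Rightarrow> 'a \<Rightarrow> ('a, 'k) chart" where
  "chart_at M p = (SOME c. c \<in> atlas M \<and> p \<in> fst c)"

text \<open>The derivative \<open>\<xi> f\<close> of a function in the direction of \<open>\<xi>\<close>, a tangent vector at \<open>p\<close>;
  by the chain rule the choice of the chart does not matter.\<close>

definition dirderiv :: "('a, 'k::finite, 'z) cmanifold_scheme \<Rightarrow> 'a \<Rightarrow> ('a, 'k) tvec \<Rightarrow>
    ('a \<Rightarrow> 'b::real_normed_vector) \<Rightarrow> 'b" where
  "dirderiv M p \<xi> f =
     (let c = chart_at M p in frechet_derivative (f \<circ> cinv c) (at (snd c p)) (\<xi> c))"

definition lie_bracket :: "('a, 'k::finite, 'z) cmanifold_scheme \<Rightarrow>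
    ('a \<Rightarrow> ('a, 'k) tvec) \<Rightarrow> ('a \<Rightarrow> ('a, 'k) tvec) \<Rightarrow> 'a \<Rightarrow> ('a, 'k) tvec" where
  "lie_bracket M X Y p = (\<lambda>c. if c \<in> atlas M \<and> p \<in> fst c then
       frechet_derivative (\<lambda>x. Y (cinv c x) c) (at (snd c p)) (X p c)
     - frechet_derivative (\<lambda>x. X (cinv c x) c) (at (snd c p)) (Y p c) else 0)"

definition lin_on :: "'v::real_vector set \<Rightarrow> ('v \<Rightarrow> 'w::real_vector) \<Rightarrow> bool" where
  "lin_on S f \<longleftrightarrow> (\<forall>x\<in>S. \<forall>y\<in>S. f (x + y) = f x + f y) \<and> (\<forall>a. \<forall>x\<in>S. f (a *\<^sub>R x) = a *\<^sub>R f x)"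

definition one_form :: "('a, 'k::finite, 'z) cmanifold_scheme \<Rightarrow> 'a set \<Rightarrow>
    ('a \<Rightarrow> ('a, 'k) tvec \<Rightarrow> real) \<Rightarrow> bool" where
  "one_form M W \<alpha> \<longleftrightarrow> (\<forall>p\<in>W. lin_on (tspace M p) (\<alpha> p)) \<and>
     (\<forall>W' X. openin (mtop M) W' \<and> W' \<subseteq> W \<and> vfield M W' X \<longrightarrow> smooth_fun M W' (\<lambda>p. \<alpha> p (X p)))"

text \<open>Holomorphic (1,0)-forms, evaluated on real tangent vectors \<open>X\<close> through the usual
  identification of \<open>X\<close> with its (1,0)-part; they are complex linear with respect to
  \<open>cstruct\<close>.\<close>

definition hol_one_form :: "('a, 'k::finite, 'z) cmanifold_scheme \<Rightarrow> 'a set \<Rightarrow>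
    ('a \<Rightarrow> ('a, 'k) tvec \<Rightarrow> complex) \<Rightarrow> bool" where
  "hol_one_form M W \<alpha> \<longleftrightarrow>
     (\<forall>p\<in>W. lin_on (tspace M p) (\<alpha> p) \<and> (\<forall>\<xi>\<in>tspace M p. \<alpha> p (cstruct \<xi>) = \<i> * \<alpha> p \<xi>)) \<and>
     (\<forall>W' Z. openin (mtop M) W' \<and> W' \<subseteq> W \<and> hol_vfield M W' Z \<longrightarrow> hol_fun M W' (\<lambda>p. \<alpha> p (Z p)))"

definition tensor11 :: "('a, 'k::finite, 'z) cmanifold_scheme \<Rightarrow> 'a set \<Rightarrow>
    ('a \<Rightarrow> ('a, 'k) tvec \<Rightarrow> ('a, 'k) tvec) \<Rightarrow> bool" where
  "tensor11 M W F \<longleftrightarrow>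
     (\<forall>p\<in>W. lin_on (tspace M p) (F p) \<and> F p ` tspace M p \<subseteq> tspace M p) \<and>
     (\<forall>W' X. openin (mtop M) W' \<and> W' \<subseteq> W \<and> vfield M W' X \<longrightarrow> vfield M W' (\<lambda>p. F p (X p)))"

text \<open>Exterior derivative with the convention
  \<open>2 d\<alpha>(K,L) = K \<alpha>(L) - L \<alpha>(K) - \<alpha>([K,L])\<close>.\<close>

definition ext_deriv :: "('a, 'k::finite, 'z) cmanifold_scheme \<Rightarrow>
    ('a \<Rightarrow> ('a, 'k) tvec \<Rightarrow> 'b::real_normed_vector) \<Rightarrow>
    ('a \<Rightarrow> ('a, 'k) tvec) \<Rightarrow> ('a \<Rightarrow> ('a, 'k) tvec) \<Rightarrow> 'a \<Rightarrow> 'b" where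
  "ext_deriv M \<alpha> K L p = (1/2) *\<^sub>R
     (dirderiv M p (K p) (\<lambda>q. \<alpha> q (L q)) - dirderiv M p (L p) (\<lambda>q. \<alpha> q (K q))
      - \<alpha> p (lie_bracket M K L p))"

definition wedge11 :: "('v \<Rightarrow> real) \<Rightarrow> ('v \<Rightarrow> real) \<Rightarrow> 'v \<Rightarrow> 'v \<Rightarrow> real" where
  "wedge11 \<alpha> \<beta> \<xi> \<eta> = (\<alpha> \<xi> * \<beta> \<eta> - \<alpha> \<eta> * \<beta> \<xi>) / 2"

text \<open>Wedge product of a \<open>p\<close>-form and a \<open>q\<close>-form of arbitrary degrees, as the alternation of the
  tensor product; a form of degree \<open>p\<close> is applied to a sequence of arguments of which it uses the
  first \<open>p\<close>. For \<open>p = q = 1\<close> this is the normalization of \<open>wedge11\<close>.\<close>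

definition wedge :: "nat \<Rightarrow> nat \<Rightarrow> ((nat \<Rightarrow> 'v) \<Rightarrow> complex) \<Rightarrow> ((nat \<Rightarrow> 'v) \<Rightarrow> complex) \<Rightarrow>
    (nat \<Rightarrow> 'v) \<Rightarrow> complex" where
  "wedge p q \<alpha> \<beta> X = (\<Sum>\<pi> | \<pi> permutes {..<p + q}.
     of_int (sign \<pi>) * \<alpha> (\<lambda>i. X (\<pi> i)) * \<beta> (\<lambda>i. X (\<pi> (p + i)))) / fact (p + q)"

primrec wedge_power2 :: "((nat \<Rightarrow> 'v) \<Rightarrow> complex) \<Rightarrow> nat \<Rightarrow> (nat \<Rightarrow> 'v) \<Rightarrow> complex" where
  "wedge_power2 \<beta> 0 = (\<lambda>X. 1)"
| "wedge_power2 \<beta> (Suc m) = wedge 2 (2 * m) \<beta> (wedge_power2 \<beta> m)"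

text \<open>\<open>\<omega> \<and> (d\<omega>)^m\<close> at \<open>p\<close>, evaluated on vector fields defined near \<open>p\<close>.\<close>

definition contact_volume :: "('a, 'k::finite, 'z) cmanifold_scheme \<Rightarrow> nat \<Rightarrow>
    ('a \<Rightarrow> ('a, 'k) tvec \<Rightarrow> complex) \<Rightarrow> 'a \<Rightarrow> (nat \<Rightarrow> 'a \<Rightarrow> ('a, 'k) tvec) \<Rightarrow> complex" where
  "contact_volume M m \<omega> p =
     wedge 1 (2 * m) (\<lambda>X. \<omega> p (X 0 p)) (wedge_power2 (\<lambda>X. ext_deriv M \<omega> (X 0) (X 1) p) m)"

section \<open>Hermitian metrics and the Levi-Civita connection\<close>

definition riemannian_metric :: "('a, 'k::finite, 'z) cmanifold_scheme \<Rightarrow>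
    ('a \<Rightarrow> ('a, 'k) tvec \<Rightarrow> ('a, 'k) tvec \<Rightarrow> real) \<Rightarrow> bool" where
  "riemannian_metric M g \<longleftrightarrow>
     (\<forall>p\<in>points M. \<forall>\<xi>\<in>tspace M p. lin_on (tspace M p) (g p \<xi>) \<and>
        (\<forall>\<eta>\<in>tspace M p. g p \<xi> \<eta> = g p \<eta> \<xi>) \<and> (\<xi> \<noteq> 0 \<longrightarrow> g p \<xi> \<xi> > 0)) \<and>
     (\<forall>W X Y. openin (mtop M) W \<and> vfield M W X \<and> vfield M W Y \<longrightarrow>
        smooth_fun M W (\<lambda>p. g p (X p) (Y p)))"

definition hermitian_metric :: "('a, 'k::finite, 'z) cmanifold_scheme \<Rightarrow>
    ('a \<Rightarrow> ('a, 'k) tvec \<Rightarrow> ('a, 'k) tvec \<Rightarrow> real) \<Rightarrow> bool" where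
  "hermitian_metric M g \<longleftrightarrow> riemannian_metric M g \<and>
     (\<forall>p\<in>points M. \<forall>\<xi>\<in>tspace M p. \<forall>\<eta>\<in>tspace M p. g p (cstruct \<xi>) (cstruct \<eta>) = g p \<xi> \<eta>)"

text \<open>An affine connection is given as \<open>nab L p \<xi>\<close>, the covariant derivative at \<open>p\<close> in the
  direction of the tangent vector \<open>\<xi>\<close> of a vector field \<open>L\<close> defined near \<open>p\<close>. Fields are
  total functions whose values outside their domain are meaningless, hence the locality clause.\<close>

type_synonym ('a, 'k) connection = "('a \<Rightarrow> ('a, 'k) tvec) \<Rightarrow> 'a \<Rightarrow> ('a, 'k) tvec \<Rightarrow> ('a, 'k) tvec"

definition affine_connection ::
  "('a, 'k::finite, 'z) cmanifold_scheme \<Rightarrow> ('a, 'k) connection \<Rightarrow> bool" where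
  "affine_connection M nab \<longleftrightarrow> (\<forall>W. openin (mtop M) W \<longrightarrow>
     (\<forall>L. vfield M W L \<longrightarrow>
        (\<forall>p\<in>W. lin_on (tspace M p) (nab L p) \<and> nab L p ` tspace M p \<subseteq> tspace M p) \<and>
        (\<forall>K. vfield M W K \<longrightarrow> vfield M W (\<lambda>p. nab L p (K p))) \<and>
        (\<forall>L'. (\<forall>p\<in>W. L' p = L p) \<longrightarrow> (\<forall>p\<in>W. \<forall>\<xi>\<in>tspace M p. nab L' p \<xi> = nab L p \<xi>)) \<and>
        (\<forall>L'. vfield M W L' \<longrightarrow>
           (\<forall>p\<in>W. \<forall>\<xi>\<in>tspace M p. nab (\<lambda>q. L q + L' q) p \<xi> = nab L p \<xi> + nab L' p \<xi>)) \<and>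
        (\<forall>f::'a \<Rightarrow> real. smooth_fun M W f \<longrightarrow>
           (\<forall>p\<in>W. \<forall>\<xi>\<in>tspace M p.
              nab (\<lambda>q. f q *\<^sub>R L q) p \<xi> = dirderiv M p \<xi> f *\<^sub>R L p + f p *\<^sub>R nab L p \<xi>))))"

definition levi_civita :: "('a, 'k::finite, 'z) cmanifold_scheme \<Rightarrow>
    ('a \<Rightarrow> ('a, 'k) tvec \<Rightarrow> ('a, 'k) tvec \<Rightarrow> real) \<Rightarrow> ('a, 'k) connection \<Rightarrow> bool" where
  "levi_civita M g nab \<longleftrightarrow> affine_connection M nab \<and>
     (\<forall>W K L. openin (mtop M) W \<and> vfield M W K \<and> vfield M W L \<longrightarrow>
        (\<forall>p\<in>W. nab L p (K p) - nab K p (L p) = lie_bracket M K L p) \<and>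
        (\<forall>p\<in>W. \<forall>\<xi>\<in>tspace M p. dirderiv M p \<xi> (\<lambda>q. g q (K q) (L q)) =
           g p (nab K p \<xi>) (L p) + g p (K p) (nab L p \<xi>)))"

section \<open>Complex contact metric manifolds\<close>

text \<open>All data with an index argument \<open>'i\<close> are local, defined on the coordinate neighbourhood
  \<open>nbhd N i\<close> with \<open>i \<in> index N\<close>.\<close>

record ('a, 'k::finite, 'i) contact_manifold = "('a, 'k) cmanifold" +
  metric :: "'a \<Rightarrow> ('a, 'k) tvec \<Rightarrow> ('a, 'k) tvec \<Rightarrow> real"
  conn :: "('a, 'k) connection"
  index :: "'i set"
  nbhd :: "'i \<Rightarrow> 'a set"
  form_omega :: "'i \<Rightarrow> 'a \<Rightarrow> ('a, 'k) tvec \<Rightarrow> complex"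
  form_u :: "'i \<Rightarrow> 'a \<Rightarrow> ('a, 'k) tvec \<Rightarrow> real"
  form_v :: "'i \<Rightarrow> 'a \<Rightarrow> ('a, 'k) tvec \<Rightarrow> real"
  vec_U :: "'i \<Rightarrow> 'a \<Rightarrow> ('a, 'k) tvec"
  vec_V :: "'i \<Rightarrow> 'a \<Rightarrow> ('a, 'k) tvec"
  tens_G :: "'i \<Rightarrow> 'a \<Rightarrow> ('a, 'k) tvec \<Rightarrow> ('a, 'k) tvec"
  tens_H :: "'i \<Rightarrow> 'a \<Rightarrow> ('a, 'k) tvec \<Rightarrow> ('a, 'k) tvec"

definition complex_contact_manifold ::
  "nat \<Rightarrow> ('a, 'k::finite, 'i, 'z) contact_manifold_scheme \<Rightarrow> bool" where
  "complex_contact_manifold m N \<longleftrightarrow>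
     complex_manifold N \<and> CARD('k) = 2 * m + 1 \<and>
     (\<forall>i\<in>index N. \<exists>\<phi>. (nbhd N i, \<phi>) \<in> atlas N) \<and>
     (\<Union>i\<in>index N. nbhd N i) = points N \<and>
     (\<forall>i\<in>index N. hol_one_form N (nbhd N i) (form_omega N i) \<and>
        (\<forall>p\<in>nbhd N i. \<exists>W X. openin (mtop N) W \<and> p \<in> W \<and> (\<forall>j. vfield N W (X j)) \<and>
           contact_volume N m (form_omega N i) p X \<noteq> 0)) \<and>
     (\<forall>i\<in>index N. \<forall>j\<in>index N. nbhd N i \<inter> nbhd N j \<noteq> {} \<longrightarrow>
        (\<exists>f. hol_fun N (nbhd N i \<inter> nbhd N j) f \<and>
           (\<forall>p\<in>nbhd N i \<inter> nbhd N j. \<forall>\<xi>\<in>tspace N p.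
              form_omega N i p \<xi> = f p * form_omega N j p \<xi>)))"

text \<open>The fibre at \<open>p\<close> of the horizontal subbundle; it does not depend on the local form.\<close>

definition horizontal ::
  "('a, 'k::finite, 'i, 'z) contact_manifold_scheme \<Rightarrow> 'a \<Rightarrow> ('a, 'k) tvec set" where
  "horizontal N p = {\<xi> \<in> tspace N p. \<forall>i\<in>index N. p \<in> nbhd N i \<longrightarrow> form_omega N i p \<xi> = 0}"

definition almost_contact_metric ::
  "('a, 'k::finite, 'i, 'z) contact_manifold_scheme \<Rightarrow> bool" where
  "almost_contact_metric N \<longleftrightarrow>
     hermitian_metric N (metric N) \<and>
     (\<forall>i\<in>index N.
        one_form N (nbhd N i) (form_u N i) \<and> one_form N (nbhd N i) (form_v N i) \<and>
        vfield N (nbhd N i) (vec_U N i) \<and> vfield N (nbhd N i) (vec_V N i) \<and>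
        tensor11 N (nbhd N i) (tens_G N i) \<and> tensor11 N (nbhd N i) (tens_H N i) \<and>
        (\<forall>p\<in>nbhd N i.
           let g = metric N p; u = form_u N i p; v = form_v N i p; U = vec_U N i p;
               V = vec_V N i p; G = tens_G N i p; H = tens_H N i p
           in g U U = 1 \<and> g V V = 1 \<and> V = - cstruct U \<and> G U = 0 \<and>
              (\<forall>\<xi>\<in>tspace N p.
                 u \<xi> = g \<xi> U \<and> v \<xi> = g \<xi> V \<and> v \<xi> = u (cstruct \<xi>) \<and>
                 H \<xi> = G (cstruct \<xi>) \<and>
                 G (G \<xi>) = - \<xi> + u \<xi> *\<^sub>R U + v \<xi> *\<^sub>R V \<and>
                 H (H \<xi>) = - \<xi> + u \<xi> *\<^sub>R U + v \<xi> *\<^sub>R V \<and>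
                 G (cstruct \<xi>) = - cstruct (G \<xi>) \<and>
                 (\<forall>\<eta>\<in>tspace N p. g \<xi> (G \<eta>) = - g (G \<xi>) \<eta>)))) \<and>
     (\<forall>i\<in>index N. \<forall>j\<in>index N. nbhd N i \<inter> nbhd N j \<noteq> {} \<longrightarrow>
        (\<exists>c d :: 'a \<Rightarrow> real. \<forall>p\<in>nbhd N i \<inter> nbhd N j.
           (c p)\<^sup>2 + (d p)\<^sup>2 = 1 \<and>
           (\<forall>\<xi>\<in>tspace N p.
              form_u N j p \<xi> = c p * form_u N i p \<xi> - d p * form_v N i p \<xi> \<and>
              form_v N j p \<xi> = d p * form_u N i p \<xi> + c p * form_v N i p \<xi> \<and>
              tens_G N j p \<xi> = c p *\<^sub>R tens_G N i p \<xi> - d p *\<^sub>R tens_H N i p \<xi> \<and>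
              tens_H N j p \<xi> = d p *\<^sub>R tens_G N i p \<xi> + c p *\<^sub>R tens_H N i p \<xi>)))"

definition form_sigma ::
  "('a, 'k::finite, 'i, 'z) contact_manifold_scheme \<Rightarrow> 'i \<Rightarrow> 'a \<Rightarrow> ('a, 'k) tvec \<Rightarrow> real" where
  "form_sigma N i p \<xi> = metric N p (conn N (vec_U N i) p \<xi>) (vec_V N i p)"

definition complex_contact_metric_manifold ::
  "nat \<Rightarrow> ('a, 'k::finite, 'i, 'z) contact_manifold_scheme \<Rightarrow> bool" where
  "complex_contact_metric_manifold m N \<longleftrightarrow>
     complex_contact_manifold m N \<and> almost_contact_metric N \<and>
     levi_civita N (metric N) (conn N) \<and>
     (\<forall>i\<in>index N.
        (\<forall>p\<in>nbhd N i. horizontal N p = {\<xi> \<in> tspace N p. form_u N i p \<xi> = 0 \<and> form_v N i p \<xi> = 0}) \<and>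
        (\<forall>W K L. openin (mtop N) W \<and> W \<subseteq> nbhd N i \<and> vfield N W K \<and> vfield N W L \<longrightarrow>
           (\<forall>p\<in>W.
              ext_deriv N (form_u N i) K L p =
                metric N p (K p) (tens_G N i p (L p))
                + wedge11 (form_sigma N i p) (form_v N i p) (K p) (L p) \<and>
              ext_deriv N (form_v N i) K L p =
                metric N p (K p) (tens_H N i p (L p))
                - wedge11 (form_sigma N i p) (form_u N i p) (K p) (L p))))"

subsection \<open>Normality in the sense of Korkmaz\<close>

text \<open>\<open>(\<nabla>\<^sub>\<xi> F) L = \<nabla>\<^sub>\<xi> (F L) - F (\<nabla>\<^sub>\<xi> L)\<close>\<close>

definition cov_deriv_tensor :: "('a, 'k::finite, 'i, 'z) contact_manifold_scheme \<Rightarrow>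
    ('a \<Rightarrow> ('a, 'k) tvec \<Rightarrow> ('a, 'k) tvec) \<Rightarrow> 'a \<Rightarrow> ('a, 'k) tvec \<Rightarrow>
    ('a \<Rightarrow> ('a, 'k) tvec) \<Rightarrow> ('a, 'k) tvec" where
  "cov_deriv_tensor N F p \<xi> L = conn N (\<lambda>q. F q (L q)) p \<xi> - F p (conn N L p \<xi>)"

definition tensor_bracket :: "('a, 'k::finite, 'i, 'z) contact_manifold_scheme \<Rightarrow>
    ('a \<Rightarrow> ('a, 'k) tvec \<Rightarrow> ('a, 'k) tvec) \<Rightarrow>
    ('a \<Rightarrow> ('a, 'k) tvec) \<Rightarrow> ('a \<Rightarrow> ('a, 'k) tvec) \<Rightarrow> 'a \<Rightarrow> ('a, 'k) tvec" where
  "tensor_bracket N F K L p =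
     cov_deriv_tensor N F p (F p (K p)) L - cov_deriv_tensor N F p (F p (L p)) K
     - F p (cov_deriv_tensor N F p (K p) L) + F p (cov_deriv_tensor N F p (L p) K)"

definition korkmaz_S :: "('a, 'k::finite, 'i, 'z) contact_manifold_scheme \<Rightarrow> 'i \<Rightarrow>
    ('a \<Rightarrow> ('a, 'k) tvec) \<Rightarrow> ('a \<Rightarrow> ('a, 'k) tvec) \<Rightarrow> 'a \<Rightarrow> ('a, 'k) tvec" where
  "korkmaz_S N i K L p =
     (let g = metric N p; v = form_v N i p; s = form_sigma N i p;
          U = vec_U N i p; V = vec_V N i p; G = tens_G N i p; H = tens_H N i p;
          k = K p; l = L p
      in tensor_bracket N (tens_G N i) K L p
         + (2 * g k (G l)) *\<^sub>R U - (2 * g k (H l)) *\<^sub>R V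
         + 2 *\<^sub>R (v l *\<^sub>R H k - v k *\<^sub>R H l)
         + s (G l) *\<^sub>R H k - s (G k) *\<^sub>R H l
         + s k *\<^sub>R G (H l) - s l *\<^sub>R G (H k))"

definition korkmaz_T :: "('a, 'k::finite, 'i, 'z) contact_manifold_scheme \<Rightarrow> 'i \<Rightarrow>
    ('a \<Rightarrow> ('a, 'k) tvec) \<Rightarrow> ('a \<Rightarrow> ('a, 'k) tvec) \<Rightarrow> 'a \<Rightarrow> ('a, 'k) tvec" where
  "korkmaz_T N i K L p =
     (let g = metric N p; u = form_u N i p; s = form_sigma N i p;
          U = vec_U N i p; V = vec_V N i p; G = tens_G N i p; H = tens_H N i p;
          k = K p; l = L p
      in tensor_bracket N (tens_H N i) K L p
         - (2 * g k (G l)) *\<^sub>R U + (2 * g k (H l)) *\<^sub>R V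
         + 2 *\<^sub>R (u l *\<^sub>R G k - u k *\<^sub>R G l)
         + s (H k) *\<^sub>R G l - s (H l) *\<^sub>R G k
         + s k *\<^sub>R G (H l) - s l *\<^sub>R G (H k))"

text \<open>\<open>S\<close> and \<open>T\<close> are tensorial, so the values at \<open>p\<close> depend only on \<open>K p\<close> and \<open>L p\<close>.\<close>

definition normal_contact_metric_manifold ::
  "nat \<Rightarrow> ('a, 'k::finite, 'i, 'z) contact_manifold_scheme \<Rightarrow> bool" where
  "normal_contact_metric_manifold m N \<longleftrightarrow>
     complex_contact_metric_manifold m N \<and>
     (\<forall>i\<in>index N. \<forall>W. openin (mtop N) W \<and> W \<subseteq> nbhd N i \<longrightarrow>
        (\<forall>K L. vfield N W K \<and> vfield N W L \<longrightarrow>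
           (\<forall>p\<in>W. K p \<in> horizontal N p \<and> L p \<in> horizontal N p \<longrightarrow>
              korkmaz_S N i K L p = 0 \<and> korkmaz_T N i K L p = 0)) \<and>
        (\<forall>K. vfield N W K \<longrightarrow>
           (\<forall>p\<in>W. korkmaz_S N i K (vec_U N i) p = 0 \<and> korkmaz_T N i K (vec_V N i) p = 0)))"

section \<open>Complex submanifolds and distributions\<close>

text \<open>The differential at \<open>p\<close> of the inclusion of \<open>M\<close> into \<open>N\<close>.\<close>

definition incl_diff :: "('a, 'l::finite, 'y) cmanifold_scheme \<Rightarrow>
    ('a, 'k::finite, 'z) cmanifold_scheme \<Rightarrow> 'a \<Rightarrow> ('a, 'l) tvec \<Rightarrow> ('a, 'k) tvec" where
  "incl_diff M N p \<xi> = (\<lambda>d. if d \<in> atlas N \<and> p \<in> fst d then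
     let c = chart_at M p in frechet_derivative (transition c d) (at (snd c p)) (\<xi> c) else 0)"

text \<open>A submanifold is a subset with its own complex manifold structure whose inclusion is a
  holomorphic immersion. Its topology may be finer than the subspace topology, so embedded
  submanifolds are included as a special case. The real dimension of \<open>M\<close> is \<open>2 * CARD('l)\<close>.\<close>

definition complex_submanifold :: "('a, 'l::finite, 'y) cmanifold_scheme \<Rightarrow>
    ('a, 'k::finite, 'z) cmanifold_scheme \<Rightarrow> bool" where
  "complex_submanifold M N \<longleftrightarrow>
     complex_manifold M \<and> complex_manifold N \<and> points M \<subseteq> points N \<and>
     continuous_map (mtop M) (mtop N) (\<lambda>p. p) \<and>
     (\<forall>c\<in>atlas M. \<forall>d\<in>atlas N. hol_map_on (cimg c (fst d)) (transition c d)) \<and>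
     (\<forall>p\<in>points M. inj_on (incl_diff M N p) (tspace M p))"

definition distribution :: "('a, 'l::finite, 'y) cmanifold_scheme \<Rightarrow> nat \<Rightarrow>
    ('a \<Rightarrow> ('a, 'l) tvec set) \<Rightarrow> bool" where
  "distribution M r D \<longleftrightarrow>
     (\<forall>p\<in>points M. subspace (D p) \<and> D p \<subseteq> tspace M p \<and> dim (D p) = r) \<and>
     (\<forall>p\<in>points M. \<exists>W E. openin (mtop M) W \<and> p \<in> W \<and>
        (\<forall>a<r. vfield M W (E a)) \<and> (\<forall>q\<in>W. D q = span ((\<lambda>a. E a q) ` {..<r})))"

definition dist_sum ::
  "('a \<Rightarrow> ('a, 'l::finite) tvec set) \<Rightarrow> ('a \<Rightarrow> ('a, 'l) tvec set) \<Rightarrow> 'a \<Rightarrow> ('a, 'l) tvec set" where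
  "dist_sum D E p = {\<xi> + \<eta> | \<xi> \<eta>. \<xi> \<in> D p \<and> \<eta> \<in> E p}"

definition involutive ::
  "('a, 'l::finite, 'y) cmanifold_scheme \<Rightarrow> ('a \<Rightarrow> ('a, 'l) tvec set) \<Rightarrow> bool" where
  "involutive M D \<longleftrightarrow> (\<forall>W X Y. openin (mtop M) W \<and> vfield M W X \<and> vfield M W Y \<and>
     (\<forall>p\<in>W. X p \<in> D p \<and> Y p \<in> D p) \<longrightarrow> (\<forall>p\<in>W. lie_bracket M X Y p \<in> D p))"

definition semi_invariant_submanifold :: "('a, 'l::finite, 'y) cmanifold_scheme \<Rightarrow>
    ('a, 'k::finite, 'i, 'z) contact_manifold_scheme \<Rightarrow>
    ('a \<Rightarrow> ('a, 'l) tvec set) \<Rightarrow> ('a \<Rightarrow> ('a, 'l) tvec set) \<Rightarrow> bool" where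
  "semi_invariant_submanifold M N D D' \<longleftrightarrow>
     complex_submanifold M N \<and>
     (\<exists>r. distribution M r D) \<and> (\<exists>r. distribution M r D') \<and>
     (\<forall>p\<in>points M. \<forall>i\<in>index N. p \<in> nbhd N i \<longrightarrow>
        (let \<iota> = incl_diff M N p; T = tspace M p; g = metric N p;
             G = tens_G N i p; H = tens_H N i p;
             UV = span {vec_U N i p, vec_V N i p}
         in vec_U N i p \<in> \<iota> ` T \<and> vec_V N i p \<in> \<iota> ` T \<and>
            (\<forall>\<xi>\<in>D p. \<forall>\<eta>\<in>D' p. g (\<iota> \<xi>) (\<iota> \<eta>) = 0) \<and>
            (\<forall>\<xi>\<in>D p. \<forall>\<zeta>\<in>UV. g (\<iota> \<xi>) \<zeta> = 0) \<and>
            (\<forall>\<eta>\<in>D' p. \<forall>\<zeta>\<in>UV. g (\<iota> \<eta>) \<zeta> = 0) \<and>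
            \<iota> ` T = {\<iota> \<xi> + \<iota> \<eta> + \<zeta> | \<xi> \<eta> \<zeta>. \<xi> \<in> D p \<and> \<eta> \<in> D' p \<and> \<zeta> \<in> UV} \<and>
            G ` \<iota> ` D p = \<iota> ` D p \<and> H ` \<iota> ` D p = \<iota> ` D p \<and>
            (\<forall>\<eta>\<in>D' p. \<forall>\<tau>\<in>T. g (G (\<iota> \<eta>)) (\<iota> \<tau>) = 0 \<and> g (H (\<iota> \<eta>)) (\<iota> \<tau>) = 0)))"

text \<open>Since the ranks are constant, \<open>M\<close> is invariant or anti-invariant iff the respective
  distribution vanishes at every point; in particular a proper submanifold is nonempty.\<close>

definition proper_semi_invariant_submanifold :: "('a, 'l::finite, 'y) cmanifold_scheme \<Rightarrow>
    ('a, 'k::finite, 'i, 'z) contact_manifold_scheme \<Rightarrow>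
    ('a \<Rightarrow> ('a, 'l) tvec set) \<Rightarrow> ('a \<Rightarrow> ('a, 'l) tvec set) \<Rightarrow> bool" where
  "proper_semi_invariant_submanifold M N D D' \<longleftrightarrow>
     semi_invariant_submanifold M N D D' \<and>
     \<not> (\<forall>p\<in>points M. dim (D' p) = 0) \<and> \<not> (\<forall>p\<in>points M. dim (D p) = 0)"

end

theory Submission
  imports Defs
begin

text \<open>Since \<open>u\<close> and \<open>v\<close> vanish on \<open>D \<oplus> D\<^sup>\<bottom>\<close>, involutivity would give \<open>du(X, Y) = 0\<close> for sections \<open>X, Y\<close>
  of \<open>D\<close>. The structure equation \<open>du(X, Y) = g(X, GY) + (\<sigma> \<and> v)(X, Y)\<close> then yields \<open>g(X, GY) = 0\<close>,
  and as \<open>G\<close> maps \<open>D\<close> onto itself, \<open>D = 0\<close>.\<close>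

section \<open>Calculus of smooth maps\<close>

text \<open>The obstacle is that X and Y are fields on M, while \<open>ext_deriv\<close> on the
  ambient manifold takes fields on its open subsets; extending them would require a normal form for
  immersions. Instead, the inclusion becomes a map F between coordinate domains, and the identity
  \<alpha>(F y)(DF(y) X(y)) = 0 is differentiated along Y, its analogue for Y along X. In the
  difference the second derivatives of F cancel by symmetry. What remains relates d\<alpha> on
  fields with constant coefficients to \<alpha>(DF [X, Y]), which involutivity makes zero. This is
  why second-order calculus for \<open>Ck_on\<close> is developed. The structure equation can then
  be applied to these constant fields, because its right-hand side sees only their values at p. A
  second gap lies between sections and vectors: involutivity speaks of fields, the conclusion of
  single tangent vectors. A local frame of D closes it.\<close>

text \<open>On an open set the derivative at a point depends only on nearby values, so equality
  passes on to derivatives of every order.\<close>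

lemma Ck_on_cong:
  assumes "open S" "\<And>x. x \<in> S \<Longrightarrow> f x = g x" "Ck_on n f S"
  shows "Ck_on n g S"
  using assms(2,3)
proof (induction n arbitrary: f g)
  case 0
  then show ?case using continuous_on_cong[of S S f g] by auto
next
  case (Suc n)
  have *: "g differentiable (at x) \<and> frechet_derivative f (at x) = frechet_derivative g (at x)" if x: "x \<in> S" for x
  proof
    have d: "f differentiable (at x)" using Suc x by auto
    then have "(f has_derivative frechet_derivative f (at x)) (at x)"
      using frechet_derivative_works by blast
    then have "(g has_derivative frechet_derivative f (at x)) (at x)"
      using has_derivative_transform_within_open[of f _ x UNIV S g] assms(1) x Suc.prems(1) by auto
    then show "g differentiable (at x)" by (rule differentiableI)
    show "frechet_derivative f (at x) = frechet_derivative g (at x)"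
      using frechet_derivative_transform_within_open[OF d assms(1) x, of g] Suc.prems(1) by auto
  qed
  have "Ck_on n (\<lambda>x. frechet_derivative g (at x) v) S" for v
    using Suc.IH[of "\<lambda>x. frechet_derivative f (at x) v" "\<lambda>x. frechet_derivative g (at x) v"]
      * Suc.prems by auto
  then show ?case using * by auto
qed

text \<open>\<open>Ck_on\<close> demands continuity only of the top-order derivatives; one order
  lower it must be recovered from differentiability.\<close>

lemma Ck_on_Suc_imp: "Ck_on (Suc n) f S \<Longrightarrow> Ck_on n f S"
proof (induction n arbitrary: f)
  case 0
  then show ?case
    by (auto intro!: continuous_at_imp_continuous_on differentiable_imp_continuous_within)
next
  case (Suc n)
  from Suc.prems have "\<forall>x\<in>S. f differentiable (at x)"
    and "\<And>v. Ck_on (Suc n) (\<lambda>x. frechet_derivative f (at x) v) S"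
    unfolding Ck_on.simps(2)[of "Suc n"] by blast+
  then show ?case using Suc.IH unfolding Ck_on.simps(2)[of n f S] by simp
qed

text \<open>Replaces the chosen \<open>frechet_derivative\<close> by an explicit formula, so that
  the inductions below can work with the usual differentiation rules.\<close>

lemma Ck_on_SucI:
  assumes "open S" "\<And>x. x \<in> S \<Longrightarrow> (f has_derivative f' x) (at x)"
    and "\<And>v. Ck_on n (\<lambda>x. f' x v) S"
  shows "Ck_on (Suc n) f S"
proof -
  have "frechet_derivative f (at x) = f' x" if "x \<in> S" for x
    using frechet_derivative_at[OF assms(2)[OF that]] by simp
  then have "Ck_on n (\<lambda>x. frechet_derivative f (at x) v) S" for v
    using Ck_on_cong[OF assms(1) _ assms(3)[of v], of "\<lambda>x. frechet_derivative f (at x) v"] by auto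
  then show ?thesis using assms(2) by (auto intro: differentiableI)
qed

lemma Ck_on_SucD:
  assumes "Ck_on (Suc n) f S" "x \<in> S"
  shows "(f has_derivative frechet_derivative f (at x)) (at x)"
  using assms frechet_derivative_works by auto

lemma Ck_on_const: "open S \<Longrightarrow> Ck_on n (\<lambda>x. c) S"
  by (induction n arbitrary: c) (auto simp del: Ck_on.simps(2) intro!: Ck_on_SucI derivative_eq_intros)

lemma Ck_on_add:
  assumes "open S" "Ck_on n f S" "Ck_on n g S"
  shows "Ck_on n (\<lambda>x. f x + g x) S"
  using assms(2,3)
proof (induction n arbitrary: f g)
  case (Suc n)
  show ?case
  proof (rule Ck_on_SucI[OF assms(1)])
    show "((\<lambda>x. f x + g x) has_derivative
        (\<lambda>v. frechet_derivative f (at x) v + frechet_derivative g (at x) v)) (at x)" if "x \<in> S" for x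
      using Ck_on_SucD[OF Suc.prems(1) that] Ck_on_SucD[OF Suc.prems(2) that] by (rule has_derivative_add)
    show "Ck_on n (\<lambda>x. frechet_derivative f (at x) v + frechet_derivative g (at x) v) S" for v
      using Suc.prems by (intro Suc.IH) auto
  qed
qed (auto intro: continuous_on_add)

lemma Ck_on_sum:
  assumes "open S" "\<And>i. i \<in> I \<Longrightarrow> Ck_on n (f i) S"
  shows "Ck_on n (\<lambda>x. \<Sum>i\<in>I. f i x) S"
  using assms(2)
  by (induction I rule: infinite_finite_induct) (auto simp: Ck_on_const Ck_on_add assms(1))

lemma Ck_on_bounded_linear:
  assumes "open S" "bounded_linear L" "Ck_on n f S"
  shows "Ck_on n (\<lambda>x. L (f x)) S"
  using assms(3)
proof (induction n arbitrary: f)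
  case 0
  then show ?case using assms(2) by (auto intro: bounded_linear.continuous_on)
next
  case (Suc n)
  show ?case
  proof (rule Ck_on_SucI[OF assms(1)])
    show "((\<lambda>x. L (f x)) has_derivative (\<lambda>v. L (frechet_derivative f (at x) v))) (at x)" if "x \<in> S" for x
      using bounded_linear.has_derivative[OF assms(2) Ck_on_SucD[OF Suc.prems that]] .
  qed (use Suc in auto)
qed

lemma Ck_on_scaleR:
  assumes "open S" "Ck_on n f S" "Ck_on n g S"
  shows "Ck_on n (\<lambda>x. f x *\<^sub>R g x) S"
  using assms(2,3)
proof (induction n arbitrary: f g)
  case (Suc n)
  show ?case
  proof (rule Ck_on_SucI[OF assms(1)])
    show "((\<lambda>x. f x *\<^sub>R g x) has_derivative
        (\<lambda>v. f x *\<^sub>R frechet_derivative g (at x) v + frechet_derivative f (at x) v *\<^sub>R g x)) (at x)"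
      if "x \<in> S" for x
      using Ck_on_SucD[OF Suc.prems(1) that] Ck_on_SucD[OF Suc.prems(2) that] by (rule has_derivative_scaleR)
    show "Ck_on n (\<lambda>x. f x *\<^sub>R frechet_derivative g (at x) v + frechet_derivative f (at x) v *\<^sub>R g x) S" for v
      using Suc.prems Ck_on_Suc_imp[OF Suc.prems(1)] Ck_on_Suc_imp[OF Suc.prems(2)]
      by (intro Ck_on_add Suc.IH assms(1)) auto
  qed
qed (auto intro: continuous_on_scaleR)

lemma linear_euclidean_expansion:
  fixes L :: "'a::euclidean_space \<Rightarrow> 'b::real_vector"
  assumes "linear L"
  shows "L v = (\<Sum>b\<in>Basis. (v \<bullet> b) *\<^sub>R L b)"
proof -
  have "L v = L (\<Sum>b\<in>Basis. (v \<bullet> b) *\<^sub>R b)" by (simp add: euclidean_representation)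
  also have "\<dots> = (\<Sum>b\<in>Basis. (v \<bullet> b) *\<^sub>R L b)"
    by (simp add: linear_sum[OF assms] linear_cmul[OF assms])
  finally show ?thesis .
qed

text \<open>The chain rule applies the derivative of \<open>f\<close> to the moving vector
  \<open>g'(x) v\<close>, whereas \<open>Ck_on\<close> controls derivatives in fixed directions
  only. Expanding that vector in a basis leaves products of functions already known to be of class
  n.\<close>

lemma Ck_on_compose:
  fixes g :: "'a::real_normed_vector \<Rightarrow> 'b::euclidean_space"
  assumes "open S" "Ck_on n f T" "Ck_on n g S" "g ` S \<subseteq> T"
  shows "Ck_on n (\<lambda>x. f (g x)) S"
  using assms(2,3)
proof (induction n arbitrary: f)
  case 0
  then show ?case using assms(4) by (auto intro: continuous_on_compose2)
next
  case (Suc n)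
  let ?f' = "\<lambda>y. frechet_derivative f (at y)" and ?g' = "\<lambda>y. frechet_derivative g (at y)"
  show ?case
  proof (rule Ck_on_SucI[OF assms(1)])
    fix x assume x: "x \<in> S"
    then have gx: "g x \<in> T" using assms(4) by auto
    have "linear (?f' (g x))"
      using Ck_on_SucD[OF Suc.prems(1) gx] has_derivative_linear by blast
    then have "(\<lambda>v. \<Sum>b\<in>Basis. (?g' x v \<bullet> b) *\<^sub>R ?f' (g x) b) = (\<lambda>v. ?f' (g x) (?g' x v))"
      using linear_euclidean_expansion by metis
    then show "((\<lambda>x. f (g x)) has_derivative (\<lambda>v. \<Sum>b\<in>Basis. (?g' x v \<bullet> b) *\<^sub>R ?f' (g x) b)) (at x)"
      using has_derivative_compose[OF Ck_on_SucD[OF Suc.prems(2) x] Ck_on_SucD[OF Suc.prems(1) gx]]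
      by simp
  next
    fix v
    have g: "Ck_on n g S" using Suc.prems(2) by (rule Ck_on_Suc_imp)
    have "Ck_on n (\<lambda>x. ?g' x v \<bullet> b) S" for b
      using Ck_on_bounded_linear[OF assms(1) bounded_linear_inner_left, of n "\<lambda>x. ?g' x v" b] Suc.prems by auto
    moreover have "Ck_on n (\<lambda>x. ?f' (g x) b) S" for b
      using Suc.IH[OF _ g, of "\<lambda>y. ?f' y b"] Suc.prems by auto
    ultimately show "Ck_on n (\<lambda>x. \<Sum>b\<in>Basis. (?g' x v \<bullet> b) *\<^sub>R ?f' (g x) b) S"
      by (intro Ck_on_sum Ck_on_scaleR assms(1))
  qed
qed

section \<open>Symmetry of second derivatives\<close>

text \<open>The mean value theorem is used twice, along \<open>v\<close> for the difference of two
  parallel edges and then along \<open>w\<close>. The radius makes the ball contain the whole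
  parallelogram.\<close>

lemma second_difference_mean_value:
  fixes f :: "'a::real_normed_vector \<Rightarrow> real"
  assumes C: "Ck_on 2 f S" and t: "t > 0" and S: "cball x (t * (norm v + norm w)) \<subseteq> S"
  obtains z where "z \<in> cball x (t * (norm v + norm w))"
    "f (x + t *\<^sub>R v + t *\<^sub>R w) - f (x + t *\<^sub>R v) - f (x + t *\<^sub>R w) + f x =
      t\<^sup>2 * frechet_derivative (\<lambda>y. frechet_derivative f (at y) v) (at z) w"
proof -
  have mem: "x + s *\<^sub>R v + r *\<^sub>R w \<in> cball x (t * (norm v + norm w))"
    if "0 \<le> s" "s \<le> t" "0 \<le> r" "r \<le> t" for s r
  proof -
    have "norm (s *\<^sub>R v + r *\<^sub>R w) \<le> s * norm v + r * norm w"
      using norm_triangle_ineq[of "s *\<^sub>R v" "r *\<^sub>R w"] that by simp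
    also have "\<dots> \<le> t * norm v + t * norm w"
      using that by (intro add_mono mult_right_mono) auto
    moreover have "dist x (x + s *\<^sub>R v + r *\<^sub>R w) = norm (s *\<^sub>R v + r *\<^sub>R w)"
      by (metis add.assoc add_diff_cancel_left' dist_commute dist_norm)
    ultimately show ?thesis by (simp add: algebra_simps)
  qed
  let ?f' = "\<lambda>y. frechet_derivative f (at y)"
  let ?f'' = "\<lambda>y. frechet_derivative (\<lambda>y. ?f' y v) (at y)"
  have C1: "Ck_on (Suc 0) (\<lambda>y. ?f' y v) S" and C2: "Ck_on (Suc (Suc 0)) f S"
    using C by (auto simp: numeral_2_eq_2)
  have d1: "((\<lambda>s. f (x + s *\<^sub>R v + r *\<^sub>R w)) has_derivative (\<lambda>h. ?f' (x + s *\<^sub>R v + r *\<^sub>R w) (h *\<^sub>R v))) (at s within A)"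
    if "0 \<le> s" "s \<le> t" "0 \<le> r" "r \<le> t" for s r A
    by (rule has_derivative_compose[of "\<lambda>s. x + s *\<^sub>R v + r *\<^sub>R w" _ s A f,
          OF _ Ck_on_SucD[OF C2]]) (use mem that S in \<open>auto intro!: derivative_eq_intros\<close>)
  have d2: "((\<lambda>r. ?f' (x + s *\<^sub>R v + r *\<^sub>R w) v) has_derivative (\<lambda>h. ?f'' (x + s *\<^sub>R v + r *\<^sub>R w) (h *\<^sub>R w))) (at r within A)"
    if "0 \<le> s" "s \<le> t" "0 \<le> r" "r \<le> t" for s r A
    by (rule has_derivative_compose[of "\<lambda>r. x + s *\<^sub>R v + r *\<^sub>R w" _ r A "\<lambda>y. ?f' y v",
          OF _ Ck_on_SucD[OF C1]]) (use mem that S in \<open>auto intro!: derivative_eq_intros\<close>)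
  have lin: "?f' (x + s *\<^sub>R v + r *\<^sub>R w) (h *\<^sub>R v) = h * ?f' (x + s *\<^sub>R v + r *\<^sub>R w) v"
    "?f'' (x + s *\<^sub>R v + r *\<^sub>R w) (h *\<^sub>R w) = h * ?f'' (x + s *\<^sub>R v + r *\<^sub>R w) w"
    if "0 \<le> s" "s \<le> t" "0 \<le> r" "r \<le> t" for s r h
    using linear_cmul[OF has_derivative_linear[OF Ck_on_SucD[OF C2]]]
      linear_cmul[OF has_derivative_linear[OF Ck_on_SucD[OF C1]]] mem[OF that] S by auto
  \<comment> \<open>The idle term \<open>0 *\<^sub>R w\<close> gives both summands the shape to
    which \<open>d1\<close> applies.\<close>
  define \<phi> where "\<phi> s = f (x + s *\<^sub>R v + t *\<^sub>R w) - f (x + s *\<^sub>R v + 0 *\<^sub>R w)" for s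
  have "\<exists>s\<in>{0<..<t}. \<phi> t - \<phi> 0 =
     (\<lambda>h. ?f' (x + s *\<^sub>R v + t *\<^sub>R w) (h *\<^sub>R v) - ?f' (x + s *\<^sub>R v + 0 *\<^sub>R w) (h *\<^sub>R v)) (t - 0)"
    unfolding \<phi>_def using t by (intro mvt_simple has_derivative_diff d1) auto
  then obtain s where s: "0 < s" "s < t" and
    1: "\<phi> t - \<phi> 0 = t * (?f' (x + s *\<^sub>R v + t *\<^sub>R w) v - ?f' (x + s *\<^sub>R v + 0 *\<^sub>R w) v)"
    using t lin(1)[of _ t t] lin(1)[of _ 0 t] by (auto simp: algebra_simps)
  have "\<exists>r\<in>{0<..<t}. ?f' (x + s *\<^sub>R v + t *\<^sub>R w) v - ?f' (x + s *\<^sub>R v + 0 *\<^sub>R w) v =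
     (\<lambda>h. ?f'' (x + s *\<^sub>R v + r *\<^sub>R w) (h *\<^sub>R w)) (t - 0)"
    using t s by (intro mvt_simple d2) auto
  then obtain r where r: "0 < r" "r < t" and
    2: "?f' (x + s *\<^sub>R v + t *\<^sub>R w) v - ?f' (x + s *\<^sub>R v + 0 *\<^sub>R w) v = t * ?f'' (x + s *\<^sub>R v + r *\<^sub>R w) w"
    using t lin(2)[of s _ t] s by auto
  show ?thesis
  proof (rule that)
    show "x + s *\<^sub>R v + r *\<^sub>R w \<in> cball x (t * (norm v + norm w))" using mem s r by auto
    show "f (x + t *\<^sub>R v + t *\<^sub>R w) - f (x + t *\<^sub>R v) - f (x + t *\<^sub>R w) + f x
       = t\<^sup>2 * ?f'' (x + s *\<^sub>R v + r *\<^sub>R w) w"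
      using 1 unfolding 2 \<phi>_def by (simp add: power2_eq_square)
  qed
qed

text \<open>The second difference is symmetric in \<open>v\<close> and \<open>w\<close>, so the two
  mixed derivatives agree at some points \<open>z\<close> and \<open>z'\<close> arbitrarily close to
  \<open>x\<close>. Their continuity at \<open>x\<close> excludes a gap there.\<close>

lemma second_derivative_symmetric_real:
  fixes f :: "'a::real_normed_vector \<Rightarrow> real"
  assumes C: "Ck_on 2 f S" and S: "open S" "x \<in> S"
  shows "frechet_derivative (\<lambda>y. frechet_derivative f (at y) v) (at x) w =
         frechet_derivative (\<lambda>y. frechet_derivative f (at y) w) (at x) v" (is "?A x = ?B x")
proof (rule ccontr)
  assume ne: "?A x \<noteq> ?B x"
  define e where "e = \<bar>?A x - ?B x\<bar> / 2"
  have e: "e > 0" using ne by (simp add: e_def)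
  have "isCont ?A x" "isCont ?B x"
    using C S by (auto simp: numeral_2_eq_2 continuous_on_eq_continuous_at)
  then obtain d1 d2 where d: "d1 > 0" "\<And>y. dist y x < d1 \<Longrightarrow> dist (?A y) (?A x) < e"
    "d2 > 0" "\<And>y. dist y x < d2 \<Longrightarrow> dist (?B y) (?B x) < e"
    using e unfolding continuous_at_eps_delta by metis
  obtain d3 where d3: "d3 > 0" "ball x d3 \<subseteq> S" using S openE by blast
  define d where "d = min d1 (min d2 d3)"
  \<comment> \<open>The summand 1 keeps the denominator positive even for \<open>v = w = 0\<close>;
    the factor 2 puts the parallelogram strictly inside the ball of radius \<open>d\<close>.\<close>
  define t where "t = d / (2 * (norm v + norm w + 1))"
  have dpos: "d > 0" using d d3 by (simp add: d_def)
  have n: "norm v + norm w + 1 > 0" using norm_ge_zero[of v] norm_ge_zero[of w] by linarith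
  have t: "t > 0" using dpos n by (simp add: t_def)
  have "t * (norm v + norm w) \<le> t * (norm v + norm w + 1)" using t by simp
  also have "\<dots> = d / 2" 
  proof -
    have "d / (2 * N) * N = d / 2" if "N > 0" for N :: real using that by simp
    from this[OF n] show ?thesis by (simp only: t_def)
  qed
  also have "\<dots> < d" using dpos by simp
  finally have td: "t * (norm v + norm w) < d" .
  have sub: "cball x (t * (norm v + norm w)) \<subseteq> S" using td d3 by (auto simp: d_def)
  obtain z where z: "z \<in> cball x (t * (norm v + norm w))"
    "f (x + t *\<^sub>R v + t *\<^sub>R w) - f (x + t *\<^sub>R v) - f (x + t *\<^sub>R w) + f x = t\<^sup>2 * ?A z"
    using second_difference_mean_value[OF C t sub] by blast
  obtain z' where z': "z' \<in> cball x (t * (norm w + norm v))"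
    "f (x + t *\<^sub>R w + t *\<^sub>R v) - f (x + t *\<^sub>R w) - f (x + t *\<^sub>R v) + f x = t\<^sup>2 * ?B z'"
    using second_difference_mean_value[OF C t, of x w v] sub by (auto simp: add.commute)
  have "t\<^sup>2 * ?A z = t\<^sup>2 * ?B z'" using z(2) z'(2) by (simp add: algebra_simps)
  then have "?A z = ?B z'" using t by simp
  moreover have "dist (?A z) (?A x) < e" by (rule d(2)) (use z(1) td in \<open>auto simp: d_def dist_commute\<close>)
  moreover have "dist (?B z') (?B x) < e"
    by (rule d(4)) (use z'(1) td in \<open>auto simp: d_def dist_commute add.commute\<close>)
  moreover have False if "a = b" "dist a c < \<bar>c - d\<bar> / 2" "dist b d < \<bar>c - d\<bar> / 2" for a b c d :: real
    using that by (auto simp: dist_real_def abs_if field_simps split: if_splits)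
  ultimately show False unfolding e_def by blast
qed

lemma second_derivative_symmetric:
  fixes f :: "'a::real_normed_vector \<Rightarrow> 'b::euclidean_space"
  assumes C: "Ck_on 2 f S" and S: "open S" "x \<in> S"
  shows "frechet_derivative (\<lambda>y. frechet_derivative f (at y) v) (at x) w =
         frechet_derivative (\<lambda>y. frechet_derivative f (at y) w) (at x) v"
proof (rule euclidean_eqI)
  fix b :: 'b assume "b \<in> Basis"
  have C': "Ck_on 2 (\<lambda>y. f y \<bullet> b) S"
    using Ck_on_bounded_linear[OF S(1) bounded_linear_inner_left C] .
  have C2: "Ck_on (Suc (Suc 0)) f S" using C by (simp add: numeral_2_eq_2)
  have D: "frechet_derivative (\<lambda>y. f y \<bullet> b) (at y) v = frechet_derivative f (at y) v \<bullet> b"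
    if "y \<in> S" for y v
    using frechet_derivative_at[OF bounded_linear.has_derivative[OF bounded_linear_inner_left Ck_on_SucD[OF C2 that]]]
    by metis
  have D2: "frechet_derivative (\<lambda>y. frechet_derivative (\<lambda>y. f y \<bullet> b) (at y) v) (at x) w =
     frechet_derivative (\<lambda>y. frechet_derivative f (at y) v) (at x) w \<bullet> b" for v w
  proof -
    have "Ck_on (Suc 0) (\<lambda>y. frechet_derivative f (at y) v) S" using C2 by auto
    from Ck_on_SucD[OF this S(2)] have 1: "((\<lambda>y. frechet_derivative f (at y) v \<bullet> b) has_derivative
      (\<lambda>w. frechet_derivative (\<lambda>y. frechet_derivative f (at y) v) (at x) w \<bullet> b)) (at x)"
      by (rule bounded_linear.has_derivative[OF bounded_linear_inner_left])
    have "((\<lambda>y. frechet_derivative (\<lambda>y. f y \<bullet> b) (at y) v) has_derivative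
      (\<lambda>w. frechet_derivative (\<lambda>y. frechet_derivative f (at y) v) (at x) w \<bullet> b)) (at x)"
      by (rule has_derivative_transform_within_open[OF 1 S]) (simp add: D)
    then show ?thesis using frechet_derivative_at by metis
  qed
  show "frechet_derivative (\<lambda>y. frechet_derivative f (at y) v) (at x) w \<bullet> b =
        frechet_derivative (\<lambda>y. frechet_derivative f (at y) w) (at x) v \<bullet> b"
    using second_derivative_symmetric_real[OF C' S, of v w] by (simp add: D2)
qed

section \<open>Naturality of the exterior derivative in coordinates\<close>

text \<open>A product rule in which \<open>A\<close> is differentiable only for each fixed vector.
  Expanding \<open>W y\<close> in a basis turns the map into a finite sum of ordinary products; the
  part with frozen coefficients is then recognised as the derivative of
  \<open>A y (W x)\<close>.\<close>

lemma has_derivative_linear_family: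
  fixes A :: "'a::real_normed_vector \<Rightarrow> 'b::euclidean_space \<Rightarrow> 'c::real_normed_vector"
  assumes S: "open S" "x \<in> S" and lin: "\<And>y. y \<in> S \<Longrightarrow> linear (A y)"
    and dA: "\<And>w. (\<lambda>y. A y w) differentiable (at x)"
    and dW: "(W has_derivative W') (at x)"
  shows "((\<lambda>y. A y (W y)) has_derivative
           (\<lambda>v. frechet_derivative (\<lambda>y. A y (W x)) (at x) v + A x (W' v))) (at x)"
proof -
  let ?D = "\<lambda>w. frechet_derivative (\<lambda>y. A y w) (at x)"
  have hA: "((\<lambda>y. A y w) has_derivative ?D w) (at x)" for w
    using dA frechet_derivative_works by blast
  have "((\<lambda>y. \<Sum>b\<in>Basis. (W y \<bullet> b) *\<^sub>R A y b) has_derivative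
         (\<lambda>v. \<Sum>b\<in>Basis. (W x \<bullet> b) *\<^sub>R ?D b v + (W' v \<bullet> b) *\<^sub>R A x b)) (at x)"
    by (intro has_derivative_sum has_derivative_scaleR hA bounded_linear.has_derivative[OF bounded_linear_inner_left dW])
  moreover have "(\<Sum>b\<in>Basis. (W x \<bullet> b) *\<^sub>R ?D b v) = ?D (W x) v" for v
  proof -
    have "((\<lambda>y. \<Sum>b\<in>Basis. (W x \<bullet> b) *\<^sub>R A y b) has_derivative
         (\<lambda>v. \<Sum>b\<in>Basis. (W x \<bullet> b) *\<^sub>R ?D b v)) (at x)"
      by (intro has_derivative_sum has_derivative_scaleR_right hA)
    then have "((\<lambda>y. A y (W x)) has_derivative
         (\<lambda>v. \<Sum>b\<in>Basis. (W x \<bullet> b) *\<^sub>R ?D b v)) (at x)"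
      by (rule has_derivative_transform_within_open[OF _ S])
        (metis lin linear_euclidean_expansion)
    then show ?thesis using frechet_derivative_at by metis
  qed
  moreover have "(\<Sum>b\<in>Basis. (W' v \<bullet> b) *\<^sub>R A x b) = A x (W' v)" for v
    using linear_euclidean_expansion[OF lin[OF S(2)]] by metis
  ultimately have "((\<lambda>y. \<Sum>b\<in>Basis. (W y \<bullet> b) *\<^sub>R A y b) has_derivative
         (\<lambda>v. ?D (W x) v + A x (W' v))) (at x)"
    by (simp add: sum.distrib)
  then show ?thesis
    by (rule has_derivative_transform_within_open[OF _ S])
      (metis lin linear_euclidean_expansion)
qed

text \<open>This is d commuting with pullback, for fields annihilated by the pulled-back form. The
  left side is twice d\<alpha> on constant fields, whose bracket vanishes; on the right,
  \<open>Y' (X x) - X' (Y x)\<close> is the coordinate bracket of \<open>X\<close> and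
  \<open>Y\<close>.\<close>

lemma pullback_exterior_derivative:
  fixes F :: "'a::euclidean_space \<Rightarrow> 'b::euclidean_space" and \<alpha> :: "'b \<Rightarrow> 'b \<Rightarrow> real"
  assumes S: "open S" "x \<in> S" and F: "Ck_on 2 F S"
    and lin: "\<And>y. y \<in> S \<Longrightarrow> linear (\<alpha> (F y))"
    and d\<alpha>: "\<And>w. (\<lambda>z. \<alpha> z w) differentiable (at (F x))"
    and X: "(X has_derivative X') (at x)" and Y: "(Y has_derivative Y') (at x)"
    and X0: "\<And>y. y \<in> S \<Longrightarrow> \<alpha> (F y) (frechet_derivative F (at y) (X y)) = 0"
    and Y0: "\<And>y. y \<in> S \<Longrightarrow> \<alpha> (F y) (frechet_derivative F (at y) (Y y)) = 0"
  defines "F' \<equiv> frechet_derivative F (at x)"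
  shows "frechet_derivative (\<lambda>z. \<alpha> z (F' (Y x))) (at (F x)) (F' (X x))
       - frechet_derivative (\<lambda>z. \<alpha> z (F' (X x))) (at (F x)) (F' (Y x))
       = - \<alpha> (F x) (F' (Y' (X x) - X' (Y x)))"
proof -
  let ?DF = "\<lambda>y. frechet_derivative F (at y)"
  have C2: "Ck_on (Suc (Suc 0)) F S" using F by (simp add: numeral_2_eq_2)
  have linF: "linear (?DF y)" if "y \<in> S" for y
    using Ck_on_SucD[OF C2 that] has_derivative_linear by blast
  have dF: "(\<lambda>y. ?DF y w) differentiable (at x)" for w using C2 S by auto
  have hF: "(F has_derivative F') (at x)" unfolding F'_def using Ck_on_SucD[OF C2 S(2)] .
  have d\<alpha>F: "((\<lambda>y. \<alpha> (F y) w) has_derivative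
      (\<lambda>v. frechet_derivative (\<lambda>z. \<alpha> z w) (at (F x)) (F' v))) (at x)" for w
    using has_derivative_compose[OF hF, of "\<lambda>z. \<alpha> z w"] d\<alpha>[of w] frechet_derivative_works by blast
  \<comment> \<open>The vanishing identity differentiated in direction \<open>v\<close>. It is kept
    general in the field because it is needed for \<open>X\<close> along \<open>Y x\<close> and for
    \<open>Y\<close> along \<open>X x\<close>.\<close>
  have key: "frechet_derivative (\<lambda>z. \<alpha> z (F' (X x))) (at (F x)) (F' v) +
      \<alpha> (F x) (frechet_derivative (\<lambda>y. ?DF y (X x)) (at x) v + F' (X' v)) = 0"
    if X: "(X has_derivative X') (at x)"
      and X0: "\<And>y. y \<in> S \<Longrightarrow> \<alpha> (F y) (?DF y (X y)) = 0" for X X' v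
  proof -
    have "((\<lambda>y. ?DF y (X y)) has_derivative
        (\<lambda>v. frechet_derivative (\<lambda>y. ?DF y (X x)) (at x) v + ?DF x (X' v))) (at x)"
      by (rule has_derivative_linear_family[OF S linF dF X])
    from has_derivative_linear_family[OF S lin _ this] d\<alpha>F
    have "((\<lambda>y. \<alpha> (F y) (?DF y (X y))) has_derivative
      (\<lambda>v. frechet_derivative (\<lambda>y. \<alpha> (F y) (F' (X x))) (at x) v +
        \<alpha> (F x) (frechet_derivative (\<lambda>y. ?DF y (X x)) (at x) v + F' (X' v)))) (at x)"
      unfolding F'_def by (meson differentiableI)
    moreover have "((\<lambda>y. \<alpha> (F y) (?DF y (X y))) has_derivative (\<lambda>v. 0)) (at x)"
      by (rule has_derivative_transform_within_open[OF _ S, of "\<lambda>y. 0"]) (use X0 in auto)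
    ultimately have "(\<lambda>v. frechet_derivative (\<lambda>y. \<alpha> (F y) (F' (X x))) (at x) v +
        \<alpha> (F x) (frechet_derivative (\<lambda>y. ?DF y (X x)) (at x) v + F' (X' v))) = (\<lambda>v. 0)"
      by (rule has_derivative_unique)
    then show ?thesis using frechet_derivative_at[OF d\<alpha>F] by metis
  qed
  have sym: "frechet_derivative (\<lambda>y. ?DF y (X x)) (at x) (Y x) =
      frechet_derivative (\<lambda>y. ?DF y (Y x)) (at x) (X x)"
    using second_derivative_symmetric[OF F S] .
  show ?thesis
    using key[OF X X0, of "Y x"] key[OF Y Y0, of "X x"] sym
      linear_add[OF lin[OF S(2)]] linear_diff[OF lin[OF S(2)]] linear_diff[OF linF[OF S(2)]]
    by (simp add: F'_def)
qed

lemma Ck_on_subset: "Ck_on n f S \<Longrightarrow> T \<subseteq> S \<Longrightarrow> Ck_on n f T"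
  by (induction n arbitrary: f) (auto intro: continuous_on_subset)

lemma smooth_on_imp_differentiable: "smooth_on S f \<Longrightarrow> x \<in> S \<Longrightarrow> f differentiable (at x)"
  unfolding smooth_on_def using Ck_on.simps(2) by blast

text \<open>Holomorphy is imposed componentwise; the vector-valued map is reassembled from its
  components by the bounded linear maps \<open>axis j\<close>.\<close>

lemma hol_map_on_imp_Ck_on:
  fixes f :: "complex ^ 'k::finite \<Rightarrow> complex ^ 'l::finite"
  assumes "open S" "hol_map_on S f"
  shows "Ck_on n f S"
proof -
  have L: "bounded_linear (axis j :: complex \<Rightarrow> complex ^ 'l)" for j
    unfolding linear_conv_bounded_linear[symmetric]
    by (rule linearI) (auto simp: axis_def vec_eq_iff)
  have "Ck_on n (\<lambda>x. f x $ j) S" for j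
    using assms(2) by (auto simp: hol_map_on_def hol_on_def smooth_on_def)
  then have "Ck_on n (\<lambda>x. \<Sum>j\<in>UNIV. axis j (f x $ j)) S"
    by (intro Ck_on_sum Ck_on_bounded_linear[OF _ L] assms(1))
  moreover have "(\<Sum>j\<in>UNIV. axis j (y $ j)) = y" for y :: "complex ^ 'l"
    by (simp add: vec_eq_iff axis_def if_distrib cong: if_cong)
  ultimately show ?thesis by simp
qed

section \<open>Charts and tangent spaces\<close>

lemma
  assumes "is_chart X c"
  shows openin_chart_domain: "openin X (fst c)"
    and open_cimg: "openin X W \<Longrightarrow> open (cimg c W)"
    and cinv_chart [simp]: "p \<in> fst c \<Longrightarrow> cinv c (snd c p) = p"
proof -
  have h: "homeomorphic_map (subtopology X (fst c)) (top_of_set (snd c ` fst c)) (snd c)"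
    and o: "openin X (fst c)" and oi: "open (snd c ` fst c)"
    using assms by (auto simp: is_chart_def)
  show "openin X (fst c)" by fact
  have "topspace (subtopology X (fst c)) = fst c" using openin_subset[OF o] by auto
  then have i: "inj_on (snd c) (fst c)" using h homeomorphic_map_def by (metis homeomorphic_imp_injective_map)
  show "cinv c (snd c p) = p" if "p \<in> fst c" using i that by (simp add: cinv_def)
  show "open (cimg c W)" if W: "openin X W"
  proof -
    have "openin (subtopology X (fst c)) (W \<inter> fst c)" using W by (auto simp: openin_subtopology)
    then have "openin (top_of_set (snd c ` fst c)) (snd c ` (W \<inter> fst c))"
      using homeomorphic_imp_open_map[OF h] by (simp add: open_map_def)
    then show ?thesis using oi by (auto simp: cimg_def intro: openin_open_trans)
  qed
qed

text \<open>Covers both the inclusion of a submanifold and, for \<open>M = N\<close>, the changes of charts.\<close>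

definition smooth_inclusion ::
  "('a, 'l::finite, 'y) cmanifold_scheme \<Rightarrow> ('a, 'k::finite, 'z) cmanifold_scheme \<Rightarrow> bool" where
  "smooth_inclusion M N \<longleftrightarrow> complex_manifold M \<and> complex_manifold N \<and>
     (\<forall>c\<in>atlas M. \<forall>d\<in>atlas N. open (cimg c (fst d)) \<and>
        (\<forall>n. Ck_on n (transition c d) (cimg c (fst d))))"

lemma complex_manifold_is_chart: "complex_manifold M \<Longrightarrow> c \<in> atlas M \<Longrightarrow> is_chart (mtop M) c"
  by (simp add: complex_manifold_def)

lemma smooth_inclusion_refl:
  assumes "complex_manifold M"
  shows "smooth_inclusion M M"
proof -
  have "open (cimg c (fst d))" "hol_map_on (cimg c (fst d)) (transition c d)"
    if "c \<in> atlas M" "d \<in> atlas M" for c d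
    using that assms open_cimg openin_chart_domain complex_manifold_is_chart
    by (blast, auto simp: complex_manifold_def compatible_def)
  then show ?thesis using assms by (auto simp: smooth_inclusion_def hol_map_on_imp_Ck_on)
qed

text \<open>The topology of \<open>M\<close> may be finer than the subspace topology. Continuity of
  the inclusion is what makes the trace on \<open>M\<close> of an ambient chart domain open.\<close>

lemma complex_submanifold_imp_smooth_inclusion:
  assumes "complex_submanifold M N"
  shows "smooth_inclusion M N"
proof -
  have M: "complex_manifold M" and N: "complex_manifold N"
    and cont: "continuous_map (mtop M) (mtop N) (\<lambda>p. p)"
    and hol: "\<And>c d. c \<in> atlas M \<Longrightarrow> d \<in> atlas N \<Longrightarrow> hol_map_on (cimg c (fst d)) (transition c d)"
    using assms by (auto simp: complex_submanifold_def)
  have "open (cimg c (fst d))" if c: "c \<in> atlas M" and d: "d \<in> atlas N" for c d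
  proof -
    have "openin (mtop M) {p \<in> points M. p \<in> fst d}"
      using openin_continuous_map_preimage[OF cont] openin_chart_domain complex_manifold_is_chart N d by blast
    then have "open (cimg c {p \<in> points M. p \<in> fst d})"
      using open_cimg complex_manifold_is_chart M c by blast
    moreover have "cimg c {p \<in> points M. p \<in> fst d} = cimg c (fst d)"
      using openin_subset[OF openin_chart_domain[OF complex_manifold_is_chart[OF M c]]] by (auto simp: cimg_def)
    ultimately show ?thesis by simp
  qed
  then show ?thesis using M N hol by (auto simp: smooth_inclusion_def hol_map_on_imp_Ck_on)
qed

lemma transition_has_derivative:
  assumes "smooth_inclusion M N" "c \<in> atlas M" "d \<in> atlas N" "p \<in> fst c" "p \<in> fst d"
  shows "(transition c d has_derivative frechet_derivative (transition c d) (at (snd c p))) (at (snd c p))"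
proof (rule Ck_on_SucD)
  show "Ck_on (Suc 0) (transition c d) (cimg c (fst d))" "snd c p \<in> cimg c (fst d)"
    using assms unfolding smooth_inclusion_def cimg_def by blast+
qed

lemma linear_frechet_transition:
  assumes "smooth_inclusion M N" "c \<in> atlas M" "d \<in> atlas N" "p \<in> fst c" "p \<in> fst d"
  shows "linear (frechet_derivative (transition c d) (at (snd c p)))"
  using transition_has_derivative[OF assms] has_derivative_linear by blast

text \<open>The chain rule for three manifolds at once: depending on which of them coincide, it
  gives the cocycle rule for chart changes and the independence of \<open>incl_diff\<close> from the
  charts at its source and its target.\<close>

lemma frechet_transition_compose:
  assumes MN: "smooth_inclusion M N" and NP: "smooth_inclusion N P"
    and c: "c \<in> atlas M" "p \<in> fst c" and d: "d \<in> atlas N" "p \<in> fst d" and e: "e \<in> atlas P" "p \<in> fst e"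
  shows "frechet_derivative (transition c e) (at (snd c p)) v =
     frechet_derivative (transition d e) (at (snd d p)) (frechet_derivative (transition c d) (at (snd c p)) v)"
proof -
  have cM: "is_chart (mtop M) c" and dN: "is_chart (mtop N) d"
    using MN c(1) d(1) complex_manifold_is_chart unfolding smooth_inclusion_def by blast+
  have p: "transition c d (snd c p) = snd d p" using cM c by (simp add: transition_def)
  have "((\<lambda>x. transition d e (transition c d x)) has_derivative
      (\<lambda>v. frechet_derivative (transition d e) (at (snd d p)) (frechet_derivative (transition c d) (at (snd c p)) v)))
      (at (snd c p))"
    by (rule has_derivative_compose[OF transition_has_derivative[OF MN c(1) d(1) c(2) d(2)]])
      (simp add: p transition_has_derivative[OF NP d(1) e(1) d(2) e(2)])
  then have "(transition c e has_derivative
      (\<lambda>v. frechet_derivative (transition d e) (at (snd d p)) (frechet_derivative (transition c d) (at (snd c p)) v)))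
      (at (snd c p))"
  proof (rule has_derivative_transform_within_open)
    show "open (cimg c (fst d))" using MN c d by (auto simp: smooth_inclusion_def)
    show "snd c p \<in> cimg c (fst d)" using c d by (auto simp: cimg_def)
    show "transition d e (transition c d x) = transition c e x" if "x \<in> cimg c (fst d)" for x
      using that cM dN by (auto simp: transition_def cimg_def)
  qed
  then show ?thesis using frechet_derivative_at by metis
qed

lemma frechet_transition_self:
  assumes "complex_manifold M" "c \<in> atlas M" "p \<in> fst c"
  shows "frechet_derivative (transition c c) (at (snd c p)) v = v"
proof -
  have C: "is_chart (mtop M) c" using assms complex_manifold_is_chart by blast
  have "(transition c c has_derivative (\<lambda>v. v)) (at (snd c p))"
  proof (rule has_derivative_transform_within_open[OF has_derivative_ident])
    show "open (snd c ` fst c)" using C by (simp add: is_chart_def)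
    show "snd c p \<in> snd c ` fst c" using assms by auto
    show "x = transition c c x" if "x \<in> snd c ` fst c" for x
      using that C by (auto simp: transition_def)
  qed
  then show ?thesis using frechet_derivative_at by metis
qed

lemma tspaceI:
  assumes "\<And>c d. c \<in> atlas M \<Longrightarrow> p \<in> fst c \<Longrightarrow> d \<in> atlas M \<Longrightarrow> p \<in> fst d \<Longrightarrow>
      \<xi> d = frechet_derivative (transition c d) (at (snd c p)) (\<xi> c)"
    and "\<And>c. \<not> (c \<in> atlas M \<and> p \<in> fst c) \<Longrightarrow> \<xi> c = 0"
  shows "\<xi> \<in> tspace M p"
  unfolding tspace_def using assms by blast

lemma tspaceD:
  assumes "\<xi> \<in> tspace M p" "c \<in> atlas M" "p \<in> fst c" "d \<in> atlas M" "p \<in> fst d"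
  shows "\<xi> d = frechet_derivative (transition c d) (at (snd c p)) (\<xi> c)"
  using assms unfolding tspace_def by blast

lemma tspace_outside:
  assumes "\<xi> \<in> tspace M p" "\<not> (c \<in> atlas M \<and> p \<in> fst c)"
  shows "\<xi> c = 0"
  using assms unfolding tspace_def by blast

lemma subspace_tspace:
  assumes "complex_manifold M"
  shows "subspace (tspace M p)"
proof (rule subspaceI)
  note L = linear_frechet_transition[OF smooth_inclusion_refl[OF assms]]
  show "0 \<in> tspace M p"
    by (rule tspaceI) (simp_all add: linear_0[OF L])
  show "\<xi> + \<eta> \<in> tspace M p" if "\<xi> \<in> tspace M p" "\<eta> \<in> tspace M p" for \<xi> \<eta>
  proof (rule tspaceI)
    show "(\<xi> + \<eta>) d = frechet_derivative (transition c d) (at (snd c p)) ((\<xi> + \<eta>) c)"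
      if cd: "c \<in> atlas M" "p \<in> fst c" "d \<in> atlas M" "p \<in> fst d" for c d
      using tspaceD[OF \<open>\<xi> \<in> tspace M p\<close> cd] tspaceD[OF \<open>\<eta> \<in> tspace M p\<close> cd]
        linear_add[OF L[OF cd(1,3,2,4)]] by (metis plus_fun_apply)
    show "(\<xi> + \<eta>) c = 0" if "\<not> (c \<in> atlas M \<and> p \<in> fst c)" for c
      using tspace_outside[OF \<open>\<xi> \<in> tspace M p\<close> that] tspace_outside[OF \<open>\<eta> \<in> tspace M p\<close> that] by simp
  qed
  show "r *\<^sub>R \<xi> \<in> tspace M p" if "\<xi> \<in> tspace M p" for r \<xi>
  proof (rule tspaceI)
    show "(r *\<^sub>R \<xi>) d = frechet_derivative (transition c d) (at (snd c p)) ((r *\<^sub>R \<xi>) c)"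
      if cd: "c \<in> atlas M" "p \<in> fst c" "d \<in> atlas M" "p \<in> fst d" for c d
      using tspaceD[OF \<open>\<xi> \<in> tspace M p\<close> cd] linear_cmul[OF L[OF cd(1,3,2,4)]]
      unfolding scaleR_fun_def by metis
    show "(r *\<^sub>R \<xi>) c = 0" if "\<not> (c \<in> atlas M \<and> p \<in> fst c)" for c
      using tspace_outside[OF \<open>\<xi> \<in> tspace M p\<close> that] by (simp add: scaleR_fun_def)
  qed
qed

section \<open>Levi-Civita connection and coordinate fields\<close>

lemma levi_civita_torsion_free:
  assumes "levi_civita M g nab" "openin (mtop M) W" "vfield M W K" "vfield M W L" "p \<in> W"
  shows "nab L p (K p) - nab K p (L p) = lie_bracket M K L p"
  using assms(1)[unfolded levi_civita_def, THEN conjunct2, rule_format, of W K L] assms(2-) by blast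

lemma levi_civita_in_tspace:
  assumes "levi_civita M g nab" "openin (mtop M) W" "vfield M W L" "p \<in> W" "\<xi> \<in> tspace M p"
  shows "nab L p \<xi> \<in> tspace M p"
proof -
  have "affine_connection M nab" using assms(1) by (simp add: levi_civita_def)
  note this[unfolded affine_connection_def, rule_format, OF assms(2,3), THEN conjunct1, rule_format, OF assms(4)]
  then show ?thesis using assms(5) by blast
qed

text \<open>The field with constant coefficients \<open>w\<close> in the chart \<open>d\<close>,
  that is, a real combination of coordinate fields; the transition rule of \<open>tspace\<close>
  forces its components in all other charts.\<close>

definition coord_field ::
  "('a, 'k::finite, 'z) cmanifold_scheme \<Rightarrow> ('a, 'k) chart \<Rightarrow> complex ^ 'k \<Rightarrow> 'a \<Rightarrow> ('a, 'k) tvec" where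
  "coord_field N d w q = (\<lambda>e. if e \<in> atlas N \<and> q \<in> fst e
     then frechet_derivative (transition d e) (at (snd d q)) w else 0)"

context
  fixes N :: "('a, 'k::finite, 'z) cmanifold_scheme" and d :: "('a, 'k) chart"
  assumes N: "complex_manifold N" and d: "d \<in> atlas N"
begin

lemma coord_field_in_tspace:
  assumes "q \<in> fst d"
  shows "coord_field N d w q \<in> tspace N q"
proof (rule tspaceI)
  note I = smooth_inclusion_refl[OF N]
  show "coord_field N d w q f = frechet_derivative (transition e f) (at (snd e q)) (coord_field N d w q e)"
    if "e \<in> atlas N" "q \<in> fst e" "f \<in> atlas N" "q \<in> fst f" for e f
    unfolding coord_field_def using that frechet_transition_compose[OF I I d assms that] by simp
qed (auto simp: coord_field_def)

lemma coord_field_self: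
  assumes "q \<in> fst d"
  shows "coord_field N d w q d = w"
  using frechet_transition_self[OF N d assms] assms d by (simp add: coord_field_def)

lemma coord_field_of_tspace:
  assumes "\<xi> \<in> tspace N q" "q \<in> fst d"
  shows "coord_field N d (\<xi> d) q = \<xi>"
proof
  fix e
  show "coord_field N d (\<xi> d) q e = \<xi> e"
    using tspaceD[OF assms(1) d assms(2), of e] tspace_outside[OF assms(1), of e]
    unfolding coord_field_def by metis
qed

lemma linear_coord_field:
  assumes "q \<in> fst d"
  shows "linear (\<lambda>w. coord_field N d w q)"
proof (rule linearI)
  note I = linear_frechet_transition[OF smooth_inclusion_refl[OF N] d _ assms]
  show "coord_field N d (v + w) q = coord_field N d v q + coord_field N d w q" for v w
    by (auto simp: coord_field_def fun_eq_iff linear_add[OF I])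
  show "coord_field N d (r *\<^sub>R w) q = r *\<^sub>R coord_field N d w q" for r w
    by (auto simp: coord_field_def fun_eq_iff scaleR_fun_def linear_cmul[OF I])
qed

text \<open>In another chart \<open>e\<close> the component is a derivative of
  \<open>transition d e\<close> read at the moving point \<open>transition e d x\<close>. Class n of
  the field therefore costs class n + 1 of the transition.\<close>

lemma vfield_coord_field:
  assumes "W \<subseteq> fst d"
  shows "vfield N W (coord_field N d w)"
  unfolding vfield_def smooth_on_def
proof (intro conjI ballI allI)
  show "coord_field N d w p \<in> tspace N p" if "p \<in> W" for p
    using coord_field_in_tspace that assms by auto
  fix e n assume e: "e \<in> atlas N"
  have C: "is_chart (mtop N) e" "is_chart (mtop N) d" using N d e complex_manifold_is_chart by blast+
  have sm: "open (cimg e (fst d))" "open (cimg d (fst e))" "Ck_on n (transition e d) (cimg e (fst d))"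
    "Ck_on (Suc n) (transition d e) (cimg d (fst e))"
    using smooth_inclusion_refl[OF N] d e unfolding smooth_inclusion_def by blast+
  have "Ck_on n (\<lambda>x. frechet_derivative (transition d e) (at (transition e d x)) w) (cimg e (fst d))"
  proof (rule Ck_on_compose[OF sm(1) _ sm(3)])
    show "Ck_on n (\<lambda>y. frechet_derivative (transition d e) (at y) w) (cimg d (fst e))"
      using sm(4) by simp
    show "transition e d ` cimg e (fst d) \<subseteq> cimg d (fst e)"
      using C by (auto simp: cimg_def transition_def)
  qed
  then have "Ck_on n (\<lambda>x. coord_field N d w (cinv e x) e) (cimg e (fst d))"
    by (rule Ck_on_cong[OF sm(1), rotated])
      (use C e in \<open>auto simp: cimg_def transition_def coord_field_def\<close>)
  then show "Ck_on n (\<lambda>x. coord_field N d w (cinv e x) e) (cimg e W)"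
    by (rule Ck_on_subset) (use assms in \<open>auto simp: cimg_def\<close>)
qed

text \<open>Constant coefficients make the component of the bracket in \<open>d\<close> vanish, and
  a tangent vector is determined by its component in one chart.\<close>

lemma lie_bracket_coord_field:
  assumes L: "levi_civita N g nab" and q: "q \<in> fst d"
  shows "lie_bracket N (coord_field N d v) (coord_field N d w) q = 0"
proof -
  let ?V = "coord_field N d v" and ?W = "coord_field N d w" and ?B = "lie_bracket N (coord_field N d v) (coord_field N d w) q"
  have C: "is_chart (mtop N) d" using N d complex_manifold_is_chart by blast
  then have o: "openin (mtop N) (fst d)" by (rule openin_chart_domain)
  have V: "vfield N (fst d) ?V" "vfield N (fst d) ?W" by (auto intro: vfield_coord_field)
  \<comment> \<open>Torsion freeness spares us the coordinate invariance of the bracket.\<close>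
  have "?B = nab ?W q (?V q) - nab ?V q (?W q)"
    using levi_civita_torsion_free[OF L o V q] by simp
  moreover have "nab ?W q (?V q) \<in> tspace N q" "nab ?V q (?W q) \<in> tspace N q"
    using levi_civita_in_tspace[OF L o _ q coord_field_in_tspace[OF q]] V by blast+
  ultimately have T: "?B \<in> tspace N q" using subspace_diff[OF subspace_tspace[OF N]] by simp
  have D: "frechet_derivative (\<lambda>x. coord_field N d u (cinv d x) d) (at (snd d q)) z = 0" for u z
  proof -
    have "((\<lambda>x. coord_field N d u (cinv d x) d) has_derivative (\<lambda>z. 0)) (at (snd d q))"
    proof (rule has_derivative_transform_within_open[OF has_derivative_const])
      show "open (snd d ` fst d)" using C by (simp add: is_chart_def)
      show "snd d q \<in> snd d ` fst d" using q by auto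
      show "u = coord_field N d u (cinv d x) d" if "x \<in> snd d ` fst d" for x
        using that C by (auto simp: coord_field_self)
    qed
    then show ?thesis using frechet_derivative_at by metis
  qed
  then have "?B d = 0" by (simp add: lie_bracket_def)
  then have "coord_field N d 0 q = ?B" using coord_field_of_tspace[OF T q] by simp
  then show ?thesis using linear_0[OF linear_coord_field[OF q]] by simp
qed

end

section \<open>The differential of the inclusion\<close>

lemma chart_at_works:
  assumes "complex_manifold M" "p \<in> points M"
  shows "chart_at M p \<in> atlas M" "p \<in> fst (chart_at M p)"
proof -
  have "p \<in> (\<Union>c\<in>atlas M. fst c)" using assms unfolding complex_manifold_def by blast
  then have "\<exists>c. c \<in> atlas M \<and> p \<in> fst c" by blast
  then show "chart_at M p \<in> atlas M" "p \<in> fst (chart_at M p)"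
    unfolding chart_at_def by (metis (mono_tags, lifting) someI_ex)+
qed

context
  fixes M :: "('a, 'l::finite, 'y) cmanifold_scheme" and N :: "('a, 'k::finite, 'z) cmanifold_scheme"
    and p :: 'a
  assumes I: "smooth_inclusion M N" and p: "p \<in> points M"
begin

lemma incl_diff_apply:
  assumes "\<xi> \<in> tspace M p" "c \<in> atlas M" "p \<in> fst c" "d \<in> atlas N" "p \<in> fst d"
  shows "incl_diff M N p \<xi> d = frechet_derivative (transition c d) (at (snd c p)) (\<xi> c)"
proof -
  have M: "complex_manifold M" using I by (simp add: smooth_inclusion_def)
  note c' = chart_at_works[OF M p]
  show ?thesis
    unfolding incl_diff_def Let_def tspaceD[OF assms(1-3) c']
      frechet_transition_compose[OF smooth_inclusion_refl[OF M] I assms(2,3) c' assms(4,5), of "\<xi> c"]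
    using assms(4,5) by simp
qed

lemma incl_diff_in_tspace:
  assumes "\<xi> \<in> tspace M p"
  shows "incl_diff M N p \<xi> \<in> tspace N p"
proof -
  have M: "complex_manifold M" and N: "complex_manifold N" using I by (auto simp: smooth_inclusion_def)
  note c = chart_at_works[OF M p]
  have "incl_diff M N p \<xi> e = frechet_derivative (transition d e) (at (snd d p)) (incl_diff M N p \<xi> d)"
    if "d \<in> atlas N" "e \<in> atlas N" "p \<in> fst d" "p \<in> fst e" for d e
    unfolding incl_diff_apply[OF assms c that(1,3)] incl_diff_apply[OF assms c that(2,4)]
    by (rule frechet_transition_compose[OF I smooth_inclusion_refl[OF N] c that(1,3,2,4)])
  moreover have "incl_diff M N p \<xi> e = 0" if "\<not> (e \<in> atlas N \<and> p \<in> fst e)" for e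
    using that by (auto simp: incl_diff_def)
  ultimately show ?thesis by (intro tspaceI)
qed

text \<open>Linearity holds on all families, not merely on \<open>tspace\<close>, since only the
  component in one chart is read.\<close>

lemma linear_incl_diff: "linear (incl_diff M N p)"
proof (rule linearI)
  have M: "complex_manifold M" using I by (simp add: smooth_inclusion_def)
  note L = linear_frechet_transition[OF I chart_at_works(1)[OF M p] _ chart_at_works(2)[OF M p]]
  show "incl_diff M N p (\<xi> + \<eta>) = incl_diff M N p \<xi> + incl_diff M N p \<eta>" for \<xi> \<eta>
    by (auto simp: incl_diff_def Let_def fun_eq_iff linear_add[OF L])
  show "incl_diff M N p (r *\<^sub>R \<xi>) = r *\<^sub>R incl_diff M N p \<xi>" for r \<xi>
    by (auto simp: incl_diff_def Let_def fun_eq_iff scaleR_fun_def linear_cmul[OF L])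
qed

end

section \<open>The exterior derivative on a submanifold\<close>

text \<open>Working in charts, \<open>d\<alpha>\<close> is evaluated on coordinate fields through \<open>X p\<close> and \<open>Y p\<close>, so that
  \<open>X\<close> and \<open>Y\<close> need not be extended to the ambient manifold.\<close>

lemma ext_deriv_eq_0_on_kernel:
  fixes M :: "('a, 'l::finite, 'y) cmanifold_scheme" and N :: "('a, 'k::finite, 'z) cmanifold_scheme"
  assumes MN: "complex_submanifold M N" and L: "levi_civita N g nab"
    and \<alpha>: "one_form N B \<alpha>" and B: "openin (mtop N) B"
    and W: "openin (mtop M) W" and p: "p \<in> W" "p \<in> B"
    and X: "vfield M W X" and Y: "vfield M W Y"
    and X0: "\<And>q. q \<in> W \<Longrightarrow> q \<in> B \<Longrightarrow> \<alpha> q (incl_diff M N q (X q)) = 0"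
    and Y0: "\<And>q. q \<in> W \<Longrightarrow> q \<in> B \<Longrightarrow> \<alpha> q (incl_diff M N q (Y q)) = 0"
    and T: "lie_bracket M X Y p \<in> tspace M p"
    and XY0: "\<alpha> p (incl_diff M N p (lie_bracket M X Y p)) = 0"
  obtains V K L where "openin (mtop N) V" "V \<subseteq> B" "p \<in> V" "vfield N V K" "vfield N V L"
    "K p = incl_diff M N p (X p)" "L p = incl_diff M N p (Y p)" "ext_deriv N \<alpha> K L p = 0"
proof -
  have I: "smooth_inclusion M N" using MN by (rule complex_submanifold_imp_smooth_inclusion)
  have M: "complex_manifold M" and N: "complex_manifold N" and sub: "points M \<subseteq> points N"
    and cont: "continuous_map (mtop M) (mtop N) (\<lambda>p. p)"
    using MN by (auto simp: complex_submanifold_def)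
  have WM: "W \<subseteq> points M" using W by (rule openin_subset)
  have pM: "p \<in> points M" using p WM by auto
  define c where "c = chart_at M p"
  \<comment> \<open>This must be the chart chosen at \<open>p\<close>, because
    \<open>dirderiv\<close>, and with it \<open>ext_deriv\<close>, is computed in exactly that
    chart.\<close>
  define d where "d = chart_at N p"
  have c: "c \<in> atlas M" "p \<in> fst c" unfolding c_def by (rule chart_at_works[OF M pM])+
  have d: "d \<in> atlas N" "p \<in> fst d" unfolding d_def by (rule chart_at_works[OF N subsetD[OF sub pM]])+
  have cC: "is_chart (mtop M) c" and dC: "is_chart (mtop N) d"
    using complex_manifold_is_chart M N c(1) d(1) by blast+
  define F where "F = transition c d"
  define V where "V = B \<inter> fst d"
  have oV: "openin (mtop N) V" unfolding V_def using B openin_chart_domain[OF dC] by blast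
  \<comment> \<open>Coordinates of the points of \<open>W\<close> whose images lie in
    \<open>V\<close>; the inclusion is continuous, so this set is open.\<close>
  define S where "S = cimg c (W \<inter> {q \<in> points M. q \<in> V})"
  have S: "open S" unfolding S_def
    by (rule open_cimg[OF cC]) (use W openin_continuous_map_preimage[OF cont oV] in blast)
  have xS: "snd c p \<in> S" using p c d pM by (auto simp: S_def cimg_def V_def)
  have S_cases: "\<exists>q. q \<in> W \<and> q \<in> B \<and> q \<in> fst d \<and> q \<in> fst c \<and> q \<in> points M \<and> y = snd c q \<and>
      cinv c y = q \<and> F y = snd d q \<and> cinv d (F y) = q" if "y \<in> S" for y
    using that cC dC by (auto simp: S_def cimg_def V_def F_def transition_def)
  let ?E = "coord_field N d"
  \<comment> \<open>The coordinate expression of the form: at the point with coordinates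
    \<open>z\<close>, its value on the constant field \<open>w\<close>.\<close>
  define a where "a z w = \<alpha> (cinv d z) (?E w (cinv d z))" for z w
  have Fp: "F (snd c p) = snd d p" and Fpi: "cinv d (F (snd c p)) = p"
    using cC dC c d by (auto simp: F_def transition_def)
  let ?X = "\<lambda>y. X (cinv c y) c" and ?Y = "\<lambda>y. Y (cinv c y) c"
  let ?F' = "\<lambda>q. frechet_derivative F (at (snd c q))"
  have push: "?F' q (\<xi> c) = incl_diff M N q \<xi> d"
    if "q \<in> points M" "\<xi> \<in> tspace M q" "q \<in> fst c" "q \<in> fst d" for q \<xi>
    using incl_diff_apply[OF I that(1,2) c(1) that(3) d(1) that(4)] by (simp add: F_def)
  have E: "?E (incl_diff M N q \<xi> d) q = incl_diff M N q \<xi>"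
    if "q \<in> points M" "\<xi> \<in> tspace M q" "q \<in> fst d" for q \<xi>
    using coord_field_of_tspace[OF N d(1) incl_diff_in_tspace[OF I that(1,2)] that(3)] .
  have TX: "X q \<in> tspace M q" and TY: "Y q \<in> tspace M q" if "q \<in> W" for q
    using X Y that by (auto simp: vfield_def)
  have xW: "snd c p \<in> cimg c W" using p c by (auto simp: cimg_def)
  have dX: "(?X has_derivative frechet_derivative ?X (at (snd c p))) (at (snd c p))"
    and dY: "(?Y has_derivative frechet_derivative ?Y (at (snd c p))) (at (snd c p))"
    using smooth_on_imp_differentiable[OF _ xW] X Y c(1) frechet_derivative_works
    unfolding vfield_def by blast+
  \<comment> \<open>In coordinates: twice d\<alpha> on the constant fields through the
    pushed-forward vectors equals minus \<alpha> of the pushed-forward bracket.\<close>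
  have *: "frechet_derivative (\<lambda>z. a z (?F' p (?Y (snd c p)))) (at (F (snd c p))) (?F' p (?X (snd c p)))
       - frechet_derivative (\<lambda>z. a z (?F' p (?X (snd c p)))) (at (F (snd c p))) (?F' p (?Y (snd c p)))
       = - a (F (snd c p)) (?F' p (frechet_derivative ?Y (at (snd c p)) (?X (snd c p))
            - frechet_derivative ?X (at (snd c p)) (?Y (snd c p))))"
  proof (rule pullback_exterior_derivative[OF S xS _ _ _ dX dY])
    show "Ck_on 2 F S"
      by (rule Ck_on_subset[of _ _ "cimg c (fst d)"])
        (use I c d in \<open>auto simp: smooth_inclusion_def F_def S_def V_def cimg_def\<close>)
    show "linear (a (F y))" if y: "y \<in> S" for y
    proof -
      obtain q where q: "q \<in> B" "q \<in> fst d" "cinv d (F y) = q" using S_cases[OF y] by blast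
      have lin: "lin_on (tspace N q) (\<alpha> q)" using \<alpha> q by (auto simp: one_form_def)
      show ?thesis
        using lin coord_field_in_tspace[OF N d(1) q(2)]
        by (intro linearI) (auto simp: a_def q(3) lin_on_def
            linear_add[OF linear_coord_field[OF N d(1) q(2)]] linear_cmul[OF linear_coord_field[OF N d(1) q(2)]])
    qed
    show "(\<lambda>z. a z w) differentiable at (F (snd c p))" for w
    proof -
      have "smooth_fun N V (\<lambda>q. \<alpha> q (?E w q))"
        using \<alpha> oV vfield_coord_field[OF N d(1), of V] unfolding one_form_def V_def by blast
      then have "smooth_on (cimg d V) (\<lambda>z. a z w)"
        using d(1) by (auto simp: smooth_fun_def a_def o_def)
      then show ?thesis
        by (rule smooth_on_imp_differentiable) (use p d Fp in \<open>auto simp: cimg_def V_def\<close>)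
    qed
    have kernel: "a (F y) (frechet_derivative F (at y) (Z (cinv c y) c)) = 0"
      if y: "y \<in> S" and Z: "\<And>q. q \<in> W \<Longrightarrow> Z q \<in> tspace M q"
        and Z0: "\<And>q. q \<in> W \<Longrightarrow> q \<in> B \<Longrightarrow> \<alpha> q (incl_diff M N q (Z q)) = 0" for y Z
    proof -
      obtain q where q: "q \<in> W" "q \<in> B" "q \<in> fst d" "q \<in> fst c" "q \<in> points M" "y = snd c q"
        "cinv c y = q" "cinv d (F y) = q" using S_cases[OF y] by blast
      have "frechet_derivative F (at y) (Z (cinv c y) c) = incl_diff M N q (Z q) d"
        using push[OF q(5) Z[OF q(1)] q(4,3)] by (simp add: q(6) q(7)[unfolded q(6)])
      then show ?thesis using E[OF q(5) Z[OF q(1)] q(3)] Z0[OF q(1,2)] by (simp add: a_def q(8))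
    qed
    show "a (F y) (frechet_derivative F (at y) (?X y)) = 0" if "y \<in> S" for y
      using kernel[OF that, of X] TX X0 by blast
    show "a (F y) (frechet_derivative F (at y) (?Y y)) = 0" if "y \<in> S" for y
      using kernel[OF that, of Y] TY Y0 by blast
  qed
  have "cinv c (snd c p) = p" using cC c by simp
  then have "frechet_derivative ?Y (at (snd c p)) (?X (snd c p))
            - frechet_derivative ?X (at (snd c p)) (?Y (snd c p)) = lie_bracket M X Y p c"
    using c by (simp add: lie_bracket_def)
  then have rhs: "a (F (snd c p)) (?F' p (frechet_derivative ?Y (at (snd c p)) (?X (snd c p))
            - frechet_derivative ?X (at (snd c p)) (?Y (snd c p)))) = 0"
    using push[OF pM T c(2) d(2)] E[OF pM T d(2)] XY0 by (simp add: a_def Fpi)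
  define K where "K = ?E (incl_diff M N p (X p) d)"
  define L' where "L' = ?E (incl_diff M N p (Y p) d)"
  have KX: "K p = incl_diff M N p (X p)" "L' p = incl_diff M N p (Y p)"
    unfolding K_def L'_def using E pM TX TY p d by auto
  have lin: "lin_on (tspace N p) (\<alpha> p)" using \<alpha> p by (auto simp: one_form_def)
  \<comment> \<open>\<open>lin_on\<close> yields the value at 0 through homogeneity, applied to a
    vector known to be tangent. It is needed because the bracket of the coordinate fields is
    0.\<close>
  have "\<alpha> p 0 = \<alpha> p (0 *\<^sub>R K p)" by simp
  also have "\<dots> = 0"
    using lin coord_field_in_tspace[OF N d] unfolding lin_on_def K_def by (metis scaleR_zero_left)
  finally have "\<alpha> p (lie_bracket N K L' p) = 0"
    using lie_bracket_coord_field[OF N d(1) L d(2)] by (simp add: K_def L'_def)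
  moreover have "?F' p (?X (snd c p)) = K p d" "?F' p (?Y (snd c p)) = L' p d"
    using push[OF pM TX[OF p(1)] c(2) d(2)] push[OF pM TY[OF p(1)] c(2) d(2)] cC c by (auto simp: KX)
  \<comment> \<open>With the bracket term gone, \<open>ext_deriv\<close> is half the left side of
    the coordinate identity, and \<open>rhs\<close> makes that side vanish.\<close>
  ultimately have "ext_deriv N \<alpha> K L' p = 0"
    using * rhs unfolding ext_deriv_def dirderiv_def Let_def d_def[symmetric]
    by (simp add: Fp KX) (simp add: a_def K_def L'_def o_def)
  then show ?thesis
    using that[of V K L'] oV p d KX vfield_coord_field[OF N d(1), of V] by (auto simp: V_def K_def L'_def)
qed


section \<open>Semi-invariant submanifolds\<close>

text \<open>Metrics and tensors are linear only on tangent spaces, so the kernel is taken inside the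
  carrier. Being a subspace, it contains the span of a frame as soon as it contains the
  frame.\<close>

lemma subspace_kernel_lin_on:
  assumes S: "subspace S" and f: "lin_on S f"
  shows "subspace {x \<in> S. f x = 0}"
proof (rule subspaceI)
  have "f (0 *\<^sub>R 0) = 0 *\<^sub>R f 0" using f subspace_0[OF S] unfolding lin_on_def by blast
  then show "0 \<in> {x \<in> S. f x = 0}" using subspace_0[OF S] by simp
next
  fix x y assume xy: "x \<in> {x \<in> S. f x = 0}" "y \<in> {x \<in> S. f x = 0}"
  then have "f (x + y) = f x + f y" using f unfolding lin_on_def by blast
  then show "x + y \<in> {x \<in> S. f x = 0}" using xy subspace_add[OF S] by simp
next
  fix x and a :: real assume x: "x \<in> {x \<in> S. f x = 0}"
  then have "f (a *\<^sub>R x) = a *\<^sub>R f x" using f unfolding lin_on_def by blast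
  then show "a *\<^sub>R x \<in> {x \<in> S. f x = 0}" using x subspace_scale[OF S] by simp
qed

lemma lin_on_compose:
  assumes "lin_on S f" "lin_on T h" "f ` S \<subseteq> T"
  shows "lin_on S (\<lambda>x. h (f x))"
  unfolding lin_on_def
proof (intro conjI ballI allI)
  fix x y assume xy: "x \<in> S" "y \<in> S"
  then have "f (x + y) = f x + f y" "f x \<in> T" "f y \<in> T"
    using assms(1,3) unfolding lin_on_def by blast+
  then show "h (f (x + y)) = h (f x) + h (f y)" using assms(2) unfolding lin_on_def by metis
next
  fix a x assume "x \<in> S"
  then have "f (a *\<^sub>R x) = a *\<^sub>R f x" "f x \<in> T" using assms(1,3) unfolding lin_on_def by blast+
  then show "h (f (a *\<^sub>R x)) = a *\<^sub>R h (f x)" using assms(2) unfolding lin_on_def by metis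
qed

lemma almost_contact_metricD:
  assumes "almost_contact_metric N" "i \<in> index N"
  shows "one_form N (nbhd N i) (form_u N i)"
    and "tensor11 N (nbhd N i) (tens_G N i)"
    and "p \<in> nbhd N i \<Longrightarrow> \<xi> \<in> tspace N p \<Longrightarrow> form_u N i p \<xi> = metric N p \<xi> (vec_U N i p)"
    and "p \<in> nbhd N i \<Longrightarrow> \<xi> \<in> tspace N p \<Longrightarrow> form_v N i p \<xi> = metric N p \<xi> (vec_V N i p)"
proof -
  note C = assms(1)[unfolded almost_contact_metric_def Let_def, THEN conjunct2, THEN conjunct1,
      THEN bspec, OF assms(2)]
  show "one_form N (nbhd N i) (form_u N i)"
    by (rule C[THEN conjunct1])
  show "tensor11 N (nbhd N i) (tens_G N i)"
    by (rule C[THEN conjunct2, THEN conjunct2, THEN conjunct2, THEN conjunct2, THEN conjunct1])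
  assume p: "p \<in> nbhd N i" and \<xi>: "\<xi> \<in> tspace N p"
  note P = C[THEN conjunct2, THEN conjunct2, THEN conjunct2, THEN conjunct2, THEN conjunct2,
      THEN conjunct2, THEN bspec, OF p, THEN conjunct2, THEN conjunct2, THEN conjunct2,
      THEN conjunct2, THEN bspec, OF \<xi>]
  show "form_u N i p \<xi> = metric N p \<xi> (vec_U N i p)" "form_v N i p \<xi> = metric N p \<xi> (vec_V N i p)"
    by (rule P[THEN conjunct1], rule P[THEN conjunct2, THEN conjunct1])
qed

lemma semi_invariant_submanifoldD:
  assumes "semi_invariant_submanifold M N D D'" "p \<in> points M" "i \<in> index N" "p \<in> nbhd N i"
  shows "\<xi> \<in> D p \<Longrightarrow> \<zeta> \<in> {vec_U N i p, vec_V N i p} \<Longrightarrow> metric N p (incl_diff M N p \<xi>) \<zeta> = 0"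
    and "\<xi> \<in> D' p \<Longrightarrow> \<zeta> \<in> {vec_U N i p, vec_V N i p} \<Longrightarrow> metric N p (incl_diff M N p \<xi>) \<zeta> = 0"
    and "tens_G N i p ` incl_diff M N p ` D p = incl_diff M N p ` D p"
proof -
  note C = assms(1)[unfolded semi_invariant_submanifold_def Let_def, THEN conjunct2, THEN conjunct2,
      THEN conjunct2, THEN bspec, OF assms(2), THEN bspec, OF assms(3), THEN mp, OF assms(4)]
  note UV = C[THEN conjunct2, THEN conjunct2, THEN conjunct2]
  have "\<zeta> \<in> span {vec_U N i p, vec_V N i p}" if "\<zeta> \<in> {vec_U N i p, vec_V N i p}"
    using that by (rule span_base)
  then show "\<xi> \<in> D p \<Longrightarrow> \<zeta> \<in> {vec_U N i p, vec_V N i p} \<Longrightarrow> metric N p (incl_diff M N p \<xi>) \<zeta> = 0"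
    and "\<xi> \<in> D' p \<Longrightarrow> \<zeta> \<in> {vec_U N i p, vec_V N i p} \<Longrightarrow> metric N p (incl_diff M N p \<xi>) \<zeta> = 0"
    using UV[THEN conjunct1] UV[THEN conjunct2, THEN conjunct1] by blast+
  show "tens_G N i p ` incl_diff M N p ` D p = incl_diff M N p ` D p"
    by (rule UV[THEN conjunct2, THEN conjunct2, THEN conjunct2, THEN conjunct1])
qed

text \<open>Involutivity can be tested only on fields, so \<open>g(X, GY) = 0\<close> is first shown
  for the members of a local frame of \<open>D\<close> around \<open>p\<close> and then extended to
  all of \<open>D p\<close> by bilinearity.\<close>

lemma invariant_distribution_trivial_if_involutive:
  fixes N :: "('a, 'k::finite, 'i, 'z) contact_manifold_scheme"
    and M :: "('a, 'l::finite, 'y) cmanifold_scheme"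
  assumes N: "complex_contact_metric_manifold m N" and S: "semi_invariant_submanifold M N D D'"
    and inv: "involutive M (dist_sum D D')" and p: "p \<in> points M"
  shows "D p = {0}"
proof -
  note N' = N[unfolded complex_contact_metric_manifold_def]
  note cN = N'[THEN conjunct1] and acm = N'[THEN conjunct2, THEN conjunct1]
    and L = N'[THEN conjunct2, THEN conjunct2, THEN conjunct1]
    and dU = N'[THEN conjunct2, THEN conjunct2, THEN conjunct2]
  note cov = cN[unfolded complex_contact_manifold_def, THEN conjunct2, THEN conjunct2, THEN conjunct2, THEN conjunct1]
    and charts = cN[unfolded complex_contact_manifold_def, THEN conjunct2, THEN conjunct2, THEN conjunct1]
  have sub: "complex_submanifold M N" using S unfolding semi_invariant_submanifold_def by (rule conjunct1)
  then have I: "smooth_inclusion M N" by (rule complex_submanifold_imp_smooth_inclusion)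
  have M: "complex_manifold M" and mN: "complex_manifold N" using I by (auto simp: smooth_inclusion_def)
  have "p \<in> points N" using sub p unfolding complex_submanifold_def by blast
  then obtain i where i: "i \<in> index N" "p \<in> nbhd N i"
    using cov by blast
  obtain \<phi> where "(nbhd N i, \<phi>) \<in> atlas N" using charts i(1) by blast
  then have B: "openin (mtop N) (nbhd N i)"
    using openin_chart_domain[OF complex_manifold_is_chart[OF mN]] by fastforce
  note S' = S[unfolded semi_invariant_submanifold_def, THEN conjunct2]
  obtain r where r: "distribution M r D" using S'[THEN conjunct1] ..
  obtain r' where r': "distribution M r' D'" using S'[THEN conjunct2, THEN conjunct1] ..
  have D: "subspace (D q)" "D q \<subseteq> tspace M q" "subspace (D' q)" "D' q \<subseteq> tspace M q"
    if "q \<in> points M" for q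
  proof -
    show "subspace (D q)" "D q \<subseteq> tspace M q" "subspace (D' q)" "D' q \<subseteq> tspace M q"
      using r[unfolded distribution_def, THEN conjunct1, THEN bspec, OF that]
        r'[unfolded distribution_def, THEN conjunct1, THEN bspec, OF that] by blast+
  qed
  obtain W E where W: "openin (mtop M) W" "p \<in> W" and E: "\<And>a. a < r \<Longrightarrow> vfield M W (E a)"
    and span: "\<And>q. q \<in> W \<Longrightarrow> D q = span ((\<lambda>a. E a q) ` {..<r})"
    using r[unfolded distribution_def, THEN conjunct2, THEN bspec, OF p] by blast
  have WM: "q \<in> points M" if "q \<in> W" for q using openin_subset[OF W(1)] that by auto
  have ED: "E a q \<in> D q" if "a < r" "q \<in> W" for a q
    unfolding span[OF that(2)] using that by (intro span_base) auto
  let ?\<iota> = "incl_diff M N" and ?g = "metric N p" and ?G = "tens_G N i p"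
  have lin: "linear (?\<iota> p)" using linear_incl_diff[OF I p] .
  have \<iota>T: "?\<iota> q \<xi> \<in> tspace N q" if "q \<in> points M" "\<xi> \<in> tspace M q" for q \<xi>
    using incl_diff_in_tspace[OF I that] .
  have uD: "form_u N i q (?\<iota> q \<xi>) = 0" and vD: "form_v N i q (?\<iota> q \<xi>) = 0"
    if "q \<in> points M" "q \<in> nbhd N i" "\<xi> \<in> D q \<or> \<xi> \<in> D' q" for q \<xi>
  proof -
    have "?\<iota> q \<xi> \<in> tspace N q" using that(3) D(2,4)[OF that(1)] \<iota>T[OF that(1)] by blast
    note uv = almost_contact_metricD(3,4)[OF acm i(1) that(2) this]
    note 0 = semi_invariant_submanifoldD(1,2)[OF S that(1) i(1) that(2), of \<xi>]
    show "form_u N i q (?\<iota> q \<xi>) = 0" "form_v N i q (?\<iota> q \<xi>) = 0"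
      unfolding uv using that(3) 0[of "vec_U N i q"] 0[of "vec_V N i q"] by blast+
  qed
  have frame: "?g (?\<iota> p (E a p)) (?G (?\<iota> p (E b p))) = 0" if ab: "a < r" "b < r" for a b
  proof -
    let ?X = "lie_bracket M (E a) (E b) p"
    have "E a q \<in> dist_sum D D' q" if "a < r" "q \<in> W" for a q
      using ED[OF that] subspace_0[OF D(3)[OF WM[OF that(2)]]] unfolding dist_sum_def
      by (metis (mono_tags, lifting) add.right_neutral mem_Collect_eq)
    \<comment> \<open>The bracket may well leave \<open>D\<close>; its component in
      \<open>D'\<close> is harmless because \<open>u\<close> vanishes there too.\<close>
    then have "?X \<in> dist_sum D D' p"
      using inv[unfolded involutive_def, rule_format, of W "E a" "E b" p] W E ab by blast
    then obtain \<xi> \<eta> where X: "?X = \<xi> + \<eta>" "\<xi> \<in> D p" "\<eta> \<in> D' p" unfolding dist_sum_def by blast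
    then have T: "\<xi> \<in> tspace M p" "\<eta> \<in> tspace M p" using D(2,4)[OF p] by blast+
    then have XT: "?X \<in> tspace M p" using X(1) subspace_add[OF subspace_tspace[OF M]] by simp
    have "lin_on (tspace N p) (form_u N i p)"
      using almost_contact_metricD(1)[OF acm i(1)] i(2) by (simp add: one_form_def)
    then have uX: "form_u N i p (?\<iota> p ?X) = 0"
      using \<iota>T[OF p] T uD[OF p i(2)] X by (simp add: X(1) linear_add[OF lin] lin_on_def)
    have u0: "form_u N i q (?\<iota> q (E a q)) = 0" if "a < r" "q \<in> W" "q \<in> nbhd N i" for a q
      using uD[OF WM[OF that(2)] that(3)] ED[OF that(1,2)] by blast
    obtain V K L' where V: "openin (mtop N) V" "V \<subseteq> nbhd N i" "p \<in> V" "vfield N V K" "vfield N V L'"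
      and KL: "K p = ?\<iota> p (E a p)" "L' p = ?\<iota> p (E b p)"
      and 0: "ext_deriv N (form_u N i) K L' p = 0"
      by (rule ext_deriv_eq_0_on_kernel[OF sub L almost_contact_metricD(1)[OF acm i(1)] B W i(2)
            E[OF ab(1)] E[OF ab(2)] u0[OF ab(1)] u0[OF ab(2)] XT uX])
    have "ext_deriv N (form_u N i) K L' p = ?g (K p) (?G (L' p))
        + wedge11 (form_sigma N i p) (form_v N i p) (K p) (L' p)"
      using dU[THEN bspec, OF i(1), THEN conjunct2] V by blast
    moreover have "form_v N i p (K p) = 0" "form_v N i p (L' p) = 0"
      unfolding KL using vD[OF p i(2)] ED[OF ab(1) W(2)] ED[OF ab(2) W(2)] by blast+
    ultimately show ?thesis using 0 KL by (simp add: wedge11_def)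
  qed
  have g: "lin_on (tspace N p) (?g \<zeta>)" "\<eta> \<in> tspace N p \<Longrightarrow> ?g \<zeta> \<eta> = ?g \<eta> \<zeta>" "\<zeta> \<noteq> 0 \<Longrightarrow> ?g \<zeta> \<zeta> > 0"
    if "\<zeta> \<in> tspace N p" for \<zeta> \<eta>
  proof -
    note R = acm[unfolded almost_contact_metric_def hermitian_metric_def riemannian_metric_def,
        THEN conjunct1, THEN conjunct1, THEN conjunct1, THEN bspec, OF \<open>p \<in> points N\<close>, THEN bspec, OF that]
    show "lin_on (tspace N p) (?g \<zeta>)" "\<eta> \<in> tspace N p \<Longrightarrow> ?g \<zeta> \<eta> = ?g \<eta> \<zeta>" "\<zeta> \<noteq> 0 \<Longrightarrow> ?g \<zeta> \<zeta> > 0"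
      using R by blast+
  qed
  note tG = almost_contact_metricD(2)[OF acm i(1), unfolded tensor11_def, THEN conjunct1, THEN bspec, OF i(2)]
  have G: "?G \<zeta> \<in> tspace N p" if "\<zeta> \<in> tspace N p" for \<zeta>
    using tG that by blast
  note T = subspace_tspace[OF M, of p]
  have ET: "E a p \<in> tspace M p" if "a < r" for a using ED[OF that W(2)] D(2)[OF p] by blast
  have \<iota>: "lin_on (tspace M p) (?\<iota> p)" "?\<iota> p ` tspace M p \<subseteq> tspace N p"
    using \<iota>T[OF p] by (auto simp: lin_on_def linear_add[OF lin] linear_cmul[OF lin])
  have sub1: "subspace {\<xi> \<in> tspace M p. ?g \<zeta> (?\<iota> p \<xi>) = 0}" if "\<zeta> \<in> tspace N p" for \<zeta>
    by (intro subspace_kernel_lin_on[OF T] lin_on_compose[OF \<iota>(1) _ \<iota>(2)] g(1)[OF that])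
  have sub2: "subspace {\<eta> \<in> tspace M p. ?g \<zeta> (?G (?\<iota> p \<eta>)) = 0}" if "\<zeta> \<in> tspace N p" for \<zeta>
    by (intro subspace_kernel_lin_on[OF T] lin_on_compose[OF \<iota>(1) _ \<iota>(2)]
        lin_on_compose[OF tG[THEN conjunct1] g(1)[OF that] tG[THEN conjunct2]])
  have 1: "?g (?\<iota> p (E a p)) (?G (?\<iota> p \<eta>)) = 0" if "a < r" "\<eta> \<in> D p" for a \<eta>
    using span_minimal[OF _ sub2[OF \<iota>T[OF p ET[OF that(1)]]], of "(\<lambda>a. E a p) ` {..<r}"]
      frame that ET span[OF W(2)] by auto
  \<comment> \<open>Linearity of the metric is recorded in its second argument, so symmetry swaps
    the arguments before the span argument is repeated for \<xi>.\<close>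
  have 2: "?g (?\<iota> p \<xi>) (?G (?\<iota> p \<eta>)) = 0" if "\<xi> \<in> D p" "\<eta> \<in> D p" for \<xi> \<eta>
  proof -
    have G\<eta>: "?G (?\<iota> p \<eta>) \<in> tspace N p" using G \<iota>T[OF p] that(2) D(2)[OF p] by blast
    have "?g (?G (?\<iota> p \<eta>)) (?\<iota> p (E a p)) = 0" if "a < r" for a
      using 1[OF that \<open>\<eta> \<in> D p\<close>] g(2)[OF \<iota>T[OF p ET[OF that]] G\<eta>] by simp
    then have "D p \<subseteq> {\<xi> \<in> tspace M p. ?g (?G (?\<iota> p \<eta>)) (?\<iota> p \<xi>) = 0}"
      unfolding span[OF W(2)] using ET by (intro span_minimal sub1[OF G\<eta>]) auto
    then have "?g (?G (?\<iota> p \<eta>)) (?\<iota> p \<xi>) = 0" "\<xi> \<in> tspace M p" using that(1) by auto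
    then show ?thesis using g(2)[OF \<iota>T[OF p] G\<eta>, of \<xi>] by simp
  qed
  have "\<xi> = 0" if "\<xi> \<in> D p" for \<xi>
  proof -
    have "?\<iota> p \<xi> \<in> ?G ` ?\<iota> p ` D p"
      using semi_invariant_submanifoldD(3)[OF S p i] that by blast
    then obtain \<eta> where "\<eta> \<in> D p" "?\<iota> p \<xi> = ?G (?\<iota> p \<eta>)" by blast
    then have "?g (?\<iota> p \<xi>) (?\<iota> p \<xi>) = 0" using 2[OF that] by metis
    moreover have \<xi>: "\<xi> \<in> tspace M p" using that D(2)[OF p] by auto
    ultimately have "?\<iota> p \<xi> = ?\<iota> p 0" using g(3)[OF \<iota>T[OF p \<xi>]] linear_0[OF lin] by force
    \<comment> \<open>Positivity of the ambient metric kills only the image of \<xi>; the immersion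
      property carries this back to \<xi>.\<close>
    moreover have "inj_on (?\<iota> p) (tspace M p)" using sub p unfolding complex_submanifold_def by blast
    ultimately show ?thesis using \<xi> subspace_0[OF T] by (auto dest: inj_onD)
  qed
  then show ?thesis using subspace_0[OF D(1)[OF p]] by auto
qed

theorem corollary5p6:
  fixes N :: "('a, 'k::finite, 'i) contact_manifold"
    and M :: "('a, 'l::finite) cmanifold"
    and D D_perp :: "'a \<Rightarrow> ('a, 'l) tvec set"
    and m :: nat
  assumes "normal_contact_metric_manifold m N"
    and "proper_semi_invariant_submanifold M N D D_perp"
  shows "\<not> involutive M (dist_sum D D_perp)"
proof
  assume inv: "involutive M (dist_sum D D_perp)"
  have N: "complex_contact_metric_manifold m N"
    using assms(1) unfolding normal_contact_metric_manifold_def by (rule conjunct1)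
  have S: "semi_invariant_submanifold M N D D_perp"
    using assms(2) unfolding proper_semi_invariant_submanifold_def by (rule conjunct1)
  have "dim {0 :: ('a, 'l) tvec} = 0"
    by (rule dim_unique[of "{}"]) (auto simp: independent_empty)
  \<comment> \<open>Rank zero at every point would make \<open>M\<close> anti-invariant, contrary to
    properness.\<close>
  then have "\<forall>p\<in>points M. dim (D p) = 0"
    using invariant_distribution_trivial_if_involutive[OF N S inv] by simp
  then show False using assms(2) unfolding proper_semi_invariant_submanifold_def by blast
qed

end
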